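(* Let $n\ge 3$ and let $F_n^1$ be the complex Leibniz algebra with basis $\{e_1,\dots,e_n\}$ and $[e_1,e_1]=e_3$, $[e_i,e_1]=e_{i+1}$ for $2\le i\le n-1$. An arbitrary one-dimensional central extension of $F_n^1$ is isomorphic to one of the following pairwise non-isomorphic algebras: - $F_n^1\oplus\mathbb{C}$; - $F_{n+1}^1(0,\dots,0,\alpha_4,\alpha_3)$ with $\alpha_3,\alpha_4\in\{0,1\}$; - $L_{n+1}^{3,\lambda}$ with $\lambda\in\{-1,0,1\}$; - $L_{n+1}^{4,\lambda}$ with $\lambda\in\mathbb{C}$, $\lambda\ne0$; - $L_{n+1}^{5,\lambda,\mu}$ with $(\lambda,\mu)\in\{(1,1),(2,4)\}$; - $L_{n+1}^1$.
   Context: All vector spaces and algebras are finite-dimensional over $\mathbb{C}$; in multiplication tables omitted products of basis elements are zero. A Leibniz algebra is an algebra $L$ with bilinear product satisfying $[x,[y,z]]=[[x,y],z]-[[x,z],y]$. $\mathbb{C}$ as a direct summand denotes the one-dimensional abelian algebra. A $k$-dimensional central extension of a Leibniz algebra $L$ is a Leibniz algebra $\widehat L$ fitting into a short exact sequence of Leibniz algebras $0\to V\to\widehat L\to L\to0$ with $\dim V=k$ and the image of $V$ contained in the center of $\widehat L$; equivalently $\widehat L\cong L\oplus V$ with product $[x+u,y+v]=[x,y]_L+\theta(x,y)$, where $\theta:L\times L\to V$ is bilinear with $\theta(x,[y,z])=\theta([x,y],z)-\theta([x,z],y)$. The algebra $F_{n+1}^1(0,\dots,0,\alpha_4,\alpha_3)$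 has basis $\{e_1,\dots,e_{n+1}\}$ and products $[e_1,e_1]=e_3$, $[e_i,e_1]=e_{i+1}$ ($2\le i\le n$), $[e_1,e_2]=\alpha_3e_{n+1}$, $[e_2,e_2]=\alpha_4e_{n+1}$. The following algebras have dimension $m$ and basis $\{e_1,\dots,e_m\}$ (used with $m=n+1$): $L_m^1$: $[e_i,e_1]=e_{i+1}$ ($1\le i\le m-3$), $[e_1,e_{m-1}]=e_m+e_2$, $[e_i,e_{m-1}]=e_{i+1}$ ($2\le i\le m-3$). $L_m^{3,\lambda}$: $[e_i,e_1]=e_{i+1}$ ($1\le i\le m-3$), $[e_{m-1},e_1]=e_m+e_2$, $[e_1,e_{m-1}]=\lambda e_m$. $L_m^{4,\lambda}$: $[e_i,e_1]=e_{i+1}$ ($1\le i\le m-3$), $[e_{m-1},e_1]=e_m+e_2$, $[e_{m-1},e_{m-1}]=\lambda e_m$. $L_m^{5,\lambda,\mu}$: $[e_i,e_1]=e_{i+1}$ ($1\le i\le m-3$), $[e_{m-1},e_1]=e_m+e_2$, $[e_1,e_{m-1}]=\lambda e_m$, $[e_{m-1},e_{m-1}]=\mu e_m$.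
   Formalization: For n=3 the listed algebras L_4^{3,1} and L_4^{4,1} are in fact isomorphic, so pairwise non-isomorphism is claimed for all listed pairs except this single one when n=3. *)

theory Defs
  imports Complex_Main "HOL-Library.Function_Algebras" "HOL-Library.Product_Plus"
begin

section \<open>Finite-dimensional complex algebras\<close>

text \<open>An algebra is carried by a finite-dimensional subspace \<open>space A\<close> of an ambient complex vector
  space, so that dimensions may vary with a natural number; addition is that of the type.
  Every complex vector space arises this way (take the carrier to be the whole type).\<close>

record 'v calg =
  space :: "'v set"
  scl :: "complex \<Rightarrow> 'v \<Rightarrow> 'v"
  brk :: "'v \<Rightarrow> 'v \<Rightarrow> 'v"

definition is_algebra :: "('v::ab_group_add) calg \<Rightarrow> bool" where
  "is_algebra A \<longleftrightarrow>
     vector_space (scl A) \<and>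
     module.subspace (scl A) (space A) \<and>
     (\<exists>B. finite B \<and> module.span (scl A) B = space A) \<and>
     (\<forall>x\<in>space A. \<forall>y\<in>space A. brk A x y \<in> space A) \<and>
     (\<forall>x\<in>space A. \<forall>y\<in>space A. \<forall>z\<in>space A.
        brk A (x + y) z = brk A x z + brk A y z \<and> brk A x (y + z) = brk A x y + brk A x z) \<and>
     (\<forall>c. \<forall>x\<in>space A. \<forall>y\<in>space A.
        brk A (scl A c x) y = scl A c (brk A x y) \<and> brk A x (scl A c y) = scl A c (brk A x y))"

definition leibniz_algebra :: "('v::ab_group_add) calg \<Rightarrow> bool" where
  "leibniz_algebra A \<longleftrightarrow> is_algebra A \<and>
     (\<forall>x\<in>space A. \<forall>y\<in>space A. \<forall>z\<in>space A.
        brk A x (brk A y z) = brk A (brk A x y) z - brk A (brk A x z) y)"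

definition alg_dim :: "('v::ab_group_add) calg \<Rightarrow> nat" where
  "alg_dim A = vector_space.dim (scl A) (space A)"

definition alg_center :: "('v::ab_group_add) calg \<Rightarrow> 'v set" where
  "alg_center A = {z \<in> space A. \<forall>x\<in>space A. brk A z x = 0 \<and> brk A x z = 0}"

definition alg_hom :: "('v::ab_group_add) calg \<Rightarrow> ('w::ab_group_add) calg \<Rightarrow> ('v \<Rightarrow> 'w) \<Rightarrow> bool" where
  "alg_hom A B f \<longleftrightarrow>
     f ` space A \<subseteq> space B \<and>
     (\<forall>x\<in>space A. \<forall>y\<in>space A. f (x + y) = f x + f y) \<and>
     (\<forall>c. \<forall>x\<in>space A. f (scl A c x) = scl B c (f x)) \<and>
     (\<forall>x\<in>space A. \<forall>y\<in>space A. f (brk A x y) = brk B (f x) (f y))"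

definition alg_iso :: "('v::ab_group_add) calg \<Rightarrow> ('w::ab_group_add) calg \<Rightarrow> bool" where
  "alg_iso A B \<longleftrightarrow> (\<exists>f. alg_hom A B f \<and> bij_betw f (space A) (space B))"

definition alg_direct_sum ::
  "('v::ab_group_add) calg \<Rightarrow> ('w::ab_group_add) calg \<Rightarrow> ('v \<times> 'w) calg" where
  "alg_direct_sum A B =
     \<lparr>space = space A \<times> space B,
      scl = (\<lambda>c (x, y). (scl A c x, scl B c y)),
      brk = (\<lambda>(x, y) (x', y'). (brk A x x', brk B y y'))\<rparr>"

definition abelian_line :: "complex calg" where
  "abelian_line = \<lparr>space = UNIV, scl = (\<lambda>c x. c * x), brk = (\<lambda>x y. 0)\<rparr>"

text \<open>The maps \<open>i\<close>, \<open>p\<close> form a short exact sequence \<open>0 \<rightarrow> V \<rightarrow> E \<rightarrow> L \<rightarrow> 0\<close> of Leibniz algebras with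
  \<open>dim V = k\<close> and the image of \<open>V\<close> central in \<open>E\<close>.\<close>

definition central_extension ::
  "nat \<Rightarrow> ('u::ab_group_add) calg \<Rightarrow> ('u \<Rightarrow> 'v) \<Rightarrow> ('v::ab_group_add) calg \<Rightarrow> ('v \<Rightarrow> 'w)
     \<Rightarrow> ('w::ab_group_add) calg \<Rightarrow> bool" where
  "central_extension k V i E p L \<longleftrightarrow>
     leibniz_algebra V \<and> leibniz_algebra E \<and> leibniz_algebra L \<and>
     alg_hom V E i \<and> alg_hom E L p \<and>
     inj_on i (space V) \<and>
     i ` space V = {x \<in> space E. p x = 0} \<and>
     p ` space E = space L \<and>
     alg_dim V = k \<and>
     i ` space V \<subseteq> alg_center E"


section \<open>Algebras given by multiplication tables\<close>

text \<open>Vectors with coordinates indexed by \<open>1, \<dots>, m\<close> are functions on \<open>nat\<close> vanishing elsewhere.\<close>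

definition bvec :: "nat \<Rightarrow> nat \<Rightarrow> complex" where
  "bvec k = (\<lambda>i. if i = k then 1 else 0)"

definition cscale :: "complex \<Rightarrow> (nat \<Rightarrow> complex) \<Rightarrow> nat \<Rightarrow> complex" where
  "cscale c x = (\<lambda>i. c * x i)"

text \<open>\<open>T i j\<close> is the product of the basis vectors \<open>bvec i\<close> and \<open>bvec j\<close>.\<close>

definition table_algebra :: "nat \<Rightarrow> (nat \<Rightarrow> nat \<Rightarrow> nat \<Rightarrow> complex) \<Rightarrow> (nat \<Rightarrow> complex) calg" where
  "table_algebra m T =
     \<lparr>space = {x. \<forall>i. i \<notin> {1..m} \<longrightarrow> x i = 0},
      scl = cscale,
      brk = (\<lambda>x y. \<Sum>i\<in>{1..m}. \<Sum>j\<in>{1..m}. cscale (x i * y j) (T i j))\<rparr>"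

lemma sum_fun_apply: "(\<Sum>i\<in>A. f i) k = (\<Sum>i\<in>A. f i k)"
  for f :: "'i \<Rightarrow> nat \<Rightarrow> complex"
  by (induction A rule: infinite_finite_induct) auto

lemma brk_table_algebra:
  "brk (table_algebra m T) x y k = (\<Sum>i\<in>{1..m}. \<Sum>j\<in>{1..m}. x i * y j * T i j k)"
  by (simp add: table_algebra_def cscale_def sum_fun_apply)

definition F1 :: "nat \<Rightarrow> (nat \<Rightarrow> complex) calg" where
  "F1 n = table_algebra n (\<lambda>i j.
     if i = 1 \<and> j = 1 then bvec 3
     else if 2 \<le> i \<and> i \<le> n - 1 \<and> j = 1 then bvec (i + 1)
     else 0)"

text \<open>\<open>Fext m \<alpha>4 \<alpha>3\<close> is the algebra \<open>F\<^sub>m\<^sup>1(0, \<dots>, 0, \<alpha>4, \<alpha>3)\<close> of dimension \<open>m\<close>.\<close>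

definition Fext :: "nat \<Rightarrow> complex \<Rightarrow> complex \<Rightarrow> (nat \<Rightarrow> complex) calg" where
  "Fext m \<alpha>4 \<alpha>3 = table_algebra m (\<lambda>i j.
     if i = 1 \<and> j = 1 then bvec 3
     else if 2 \<le> i \<and> i \<le> m - 1 \<and> j = 1 then bvec (i + 1)
     else if i = 1 \<and> j = 2 then cscale \<alpha>3 (bvec m)
     else if i = 2 \<and> j = 2 then cscale \<alpha>4 (bvec m)
     else 0)"

definition L1 :: "nat \<Rightarrow> (nat \<Rightarrow> complex) calg" where
  "L1 m = table_algebra m (\<lambda>i j.
     if 1 \<le> i \<and> i \<le> m - 3 \<and> j = 1 then bvec (i + 1)
     else if i = 1 \<and> j = m - 1 then bvec m + bvec 2
     else if 2 \<le> i \<and> i \<le> m - 3 \<and> j = m - 1 then bvec (i + 1)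
     else 0)"

definition L3 :: "nat \<Rightarrow> complex \<Rightarrow> (nat \<Rightarrow> complex) calg" where
  "L3 m lam = table_algebra m (\<lambda>i j.
     if 1 \<le> i \<and> i \<le> m - 3 \<and> j = 1 then bvec (i + 1)
     else if i = m - 1 \<and> j = 1 then bvec m + bvec 2
     else if i = 1 \<and> j = m - 1 then cscale lam (bvec m)
     else 0)"

definition L4 :: "nat \<Rightarrow> complex \<Rightarrow> (nat \<Rightarrow> complex) calg" where
  "L4 m lam = table_algebra m (\<lambda>i j.
     if 1 \<le> i \<and> i \<le> m - 3 \<and> j = 1 then bvec (i + 1)
     else if i = m - 1 \<and> j = 1 then bvec m + bvec 2
     else if i = m - 1 \<and> j = m - 1 then cscale lam (bvec m)
     else 0)"

definition L5 :: "nat \<Rightarrow> complex \<Rightarrow> complex \<Rightarrow> (nat \<Rightarrow> complex) calg" where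
  "L5 m lam mu = table_algebra m (\<lambda>i j.
     if 1 \<le> i \<and> i \<le> m - 3 \<and> j = 1 then bvec (i + 1)
     else if i = m - 1 \<and> j = 1 then bvec m + bvec 2
     else if i = 1 \<and> j = m - 1 then cscale lam (bvec m)
     else if i = m - 1 \<and> j = m - 1 then cscale mu (bvec m)
     else 0)"


section \<open>The list of algebras\<close>

text \<open>The entries other than the split one are labelled, so that pairwise non-isomorphism is
  asserted for distinct entries of the list and not merely for distinct structure constants.\<close>

datatype entry =
    EF complex complex
  | EL3 complex
  | EL4 complex
  | EL5 complex complex
  | EL1

definition entries :: "entry set" where
  "entries =
     {EF \<alpha>4 \<alpha>3 | \<alpha>4 \<alpha>3. \<alpha>4 \<in> {0, 1} \<and> \<alpha>3 \<in> {0, 1}} \<union>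
     {EL3 lam | lam. lam \<in> {-1, 0, 1}} \<union>
     {EL4 lam | lam. lam \<noteq> 0} \<union>
     {EL5 lam mu | lam mu. (lam, mu) \<in> {(1, 1), (2, 4)}} \<union>
     {EL1}"

fun entry_alg :: "nat \<Rightarrow> entry \<Rightarrow> (nat \<Rightarrow> complex) calg" where
  "entry_alg m (EF \<alpha>4 \<alpha>3) = Fext m \<alpha>4 \<alpha>3"
| "entry_alg m (EL3 lam) = L3 m lam"
| "entry_alg m (EL4 lam) = L4 m lam"
| "entry_alg m (EL5 lam mu) = L5 m lam mu"
| "entry_alg m EL1 = L1 m"

text \<open>In dimension 4 two entries of the list do coincide up to isomorphism, so
  for \<open>n = 3\<close> this one pair has to be excepted from pairwise non-isomorphism.\<close>

lemma L3_L4_iso_dim4: "alg_iso (L3 4 1) (L4 4 1)"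
proof -
  define f :: "(nat \<Rightarrow> complex) \<Rightarrow> nat \<Rightarrow> complex" where
    "f = (\<lambda>x i. if i = 1 then x 1 - x 3 else if i = 2 then 2 * (x 2 - x 4)
               else if i = 3 then x 1 + x 3 else if i = 4 then 2 * x 2 else 0)"
  define g :: "(nat \<Rightarrow> complex) \<Rightarrow> nat \<Rightarrow> complex" where
    "g = (\<lambda>y i. if i = 1 then (y 1 + y 3) / 2 else if i = 2 then y 4 / 2
               else if i = 3 then (y 3 - y 1) / 2 else if i = 4 then (y 4 - y 2) / 2 else 0)"
  have I: "{1..4::nat} = {1, 2, 3, 4}" "{Suc 0..4} = {1, 2, 3, 4}" by auto
  have sp: "space (L3 4 1) = {x. \<forall>i. i \<notin> {1..4} \<longrightarrow> x i = 0}"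
           "space (L4 4 1) = {x. \<forall>i. i \<notin> {1..4} \<longrightarrow> x i = 0}"
    by (simp_all add: L3_def L4_def table_algebra_def)
  have sc: "scl (L3 4 1) = cscale" "scl (L4 4 1) = cscale"
    by (simp_all add: L3_def L4_def table_algebra_def)
  have b3: "brk (L3 4 1) x y = (\<lambda>i. if i = 2 then (x 1 + x 3) * y 1
              else if i = 4 then x 3 * y 1 + x 1 * y 3 else 0)" for x y
    by (rule ext) (simp add: L3_def brk_table_algebra I bvec_def cscale_def algebra_simps)
  have b4: "brk (L4 4 1) x y = (\<lambda>i. if i = 2 then (x 1 + x 3) * y 1
              else if i = 4 then x 3 * y 1 + x 3 * y 3 else 0)" for x y
    by (rule ext) (simp add: L4_def brk_table_algebra I bvec_def cscale_def algebra_simps)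
  have "alg_hom (L3 4 1) (L4 4 1) f"
    unfolding alg_hom_def sp sc b3 b4
    by (auto simp: f_def cscale_def fun_eq_iff algebra_simps)
  moreover have "bij_betw f (space (L3 4 1)) (space (L4 4 1))"
    unfolding sp
    by (rule bij_betw_byWitness[where f' = g]) (auto simp: f_def g_def fun_eq_iff field_simps I)
  ultimately show ?thesis unfolding alg_iso_def by blast
qed

end

theory Submission
  imports Defs
begin

text \<open>
  Write \<open>F\<close> for the algebra being extended. Its product is \<open>[x,y] = \<phi>(y) D x\<close>, where \<open>\<phi>\<close> is the
  first coordinate functional and \<open>D\<close> is right multiplication by \<open>e\<^sub>1\<close>. In terms of \<open>g = e\<^sub>2\<close>,
  \<open>h = e\<^sub>1 - e\<^sub>2\<close> and \<open>c\<^sub>k = e\<^sub>k\<^sub>+\<^sub>2\<close> the only products are \<open>[g,h] = c\<^sub>1\<close> and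
  \<open>[c\<^sub>k,h] = c\<^sub>k\<^sub>+\<^sub>1\<close>. In an extension by a central line spanned by \<open>z\<close>, lift \<open>g\<close> and \<open>h\<close> arbitrarily
  and define the \<open>c\<^sub>k\<close> by the same products. The Leibniz identity kills every product
  \<open>[x,c\<^sub>k]\<close> and \<open>[c\<^sub>k,g]\<close>, so only four scalars are left:
  \<open>[c\<^sub>n\<^sub>-\<^sub>2,h] = d z\<close>, \<open>[h,g] = q z\<close>, \<open>[g,g] = r z\<close>, \<open>[h,h] = - p z\<close>. This four-parameter family is
  \<open>F1_ext\<close>, and \<open>central_extension_of_F1\<close> proves that it exhausts the extensions. All algebras of the
  list, the split one included, belong to it: their parameters are \<open>entry_params\<close>, and
  the split one is the zero parameter.

  The advantage of the pair \<open>g, h\<close> over \<open>e\<^sub>1, e\<^sub>2\<close> is that the admissible changes of basis become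
  diagonal: \<open>g \<mapsto> S g\<close>, \<open>h \<mapsto> A h\<close>, \<open>z \<mapsto> w z\<close>, except that for \<open>d \<noteq> 0\<close> one may also add a multiple of
  \<open>c\<^sub>n\<^sub>-\<^sub>2\<close> to \<open>h\<close>, which makes \<open>p\<close> irrelevant (\<open>F1_ext_rescale\<close>). For \<open>d \<noteq> 0\<close> the scaling reduces
  \<open>(q, r)\<close> to whether each of the two vanishes, which gives the four algebras of
  type \<open>Fext\<close>. For \<open>d = 0\<close> the scaling acts on \<open>(p, q, r)\<close> by \<open>(A\<^sup>2/w, AS/w, S\<^sup>2/w)\<close>; an orbit is
  determined by the vanishing of \<open>p\<close>, \<open>q\<close>, \<open>r\<close> and by the ratio \<open>p r : q\<^sup>2\<close>. The list contains
  each nonzero orbit once, the ratio being realised by the family \<open>L4\<close>, with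
  exceptional values supplied by \<open>L3\<close>, \<open>L5\<close> and \<open>L1\<close>.

  For the converse, \<open>d \<noteq> 0\<close> is recognised by the existence of \<open>x, y\<close> such that \<open>n - 1\<close> successive right
  multiplications of \<open>x\<close> by \<open>y\<close> do not give zero. If \<open>d \<noteq> 0\<close> or \<open>n \<ge> 4\<close>, an isomorphism must send \<open>g\<close>
  and \<open>h\<close> to multiples of \<open>g\<close> and \<open>h\<close> modulo the \<open>c\<^sub>k\<close> and \<open>z\<close>, because these two directions are visible in
  products of three elements (\<open>F1_ext_iso_diagonal\<close>); hence the orbits coincide. If \<open>n = 3\<close> and \<open>d = 0\<close>,
  all products of three elements vanish and the algebra is just a pencil of bilinear forms on
  a plane. There the two degenerate forms of the pencil may be exchanged, and the exchange
  swaps the conditions \<open>p = 0\<close> and \<open>r = 0\<close> (\<open>pencil_equivalence\<close>). Among the listed algebras this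
  identifies exactly one further pair, \<open>L3\<close> and \<open>L4\<close> with parameter 1.
\<close>

section \<open>Isomorphisms of algebras\<close>

lemma alg_iso_trans:
  assumes "alg_iso A B" "alg_iso B C" shows "alg_iso A C"
proof -
  obtain f g where f: "alg_hom A B f" "bij_betw f (space A) (space B)"
    and g: "alg_hom B C g" "bij_betw g (space B) (space C)"
    using assms by (auto simp: alg_iso_def)
  have "alg_hom A C (g \<circ> f)"
    using f(1) g(1) by (auto simp: alg_hom_def image_subset_iff)
  then show ?thesis
    using bij_betw_trans[OF f(2) g(2)] by (auto simp: alg_iso_def)
qed

lemma alg_iso_sym:
  assumes "alg_iso A B"
    and "\<And>x y. x \<in> space A \<Longrightarrow> y \<in> space A \<Longrightarrow> x + y \<in> space A"
    and "\<And>c x. x \<in> space A \<Longrightarrow> scl A c x \<in> space A"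
    and "\<And>x y. x \<in> space A \<Longrightarrow> y \<in> space A \<Longrightarrow> brk A x y \<in> space A"
  shows "alg_iso B A"
proof -
  obtain f where f: "alg_hom A B f" and bij: "bij_betw f (space A) (space B)"
    using assms(1) by (auto simp: alg_iso_def)
  define g where "g = inv_into (space A) f"
  have g: "g y \<in> space A" "f (g y) = y" if "y \<in> space B" for y
    using bij that unfolding g_def
    by (auto simp: bij_betw_def intro: inv_into_into f_inv_into_f)
  have gf: "g (f x) = x" if "x \<in> space A" for x
    using bij that by (simp add: g_def bij_betw_def)
  have "alg_hom B A g"
    unfolding alg_hom_def
  proof (intro conjI ballI allI)
    show "g ` space B \<subseteq> space A" using g by auto
  next
    fix x y assume "x \<in> space B" "y \<in> space B"
    then have "f (g x + g y) = x + y" "f (brk A (g x) (g y)) = brk B x y"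
      using f g by (auto simp: alg_hom_def)
    then show "g (x + y) = g x + g y" "g (brk B x y) = brk A (g x) (g y)"
      using \<open>x \<in> space B\<close> \<open>y \<in> space B\<close> g gf assms by metis+
  next
    fix c x assume "x \<in> space B"
    then have "f (scl A c (g x)) = scl B c x"
      using f g by (auto simp: alg_hom_def)
    then show "g (scl B c x) = scl A c (g x)"
      using \<open>x \<in> space B\<close> g gf assms by metis
  qed
  moreover have "bij_betw g (space B) (space A)"
    using bij bij_betw_inv_into g_def by blast
  ultimately show ?thesis by (auto simp: alg_iso_def)
qed

section \<open>The four-parameter family of extensions\<close>

text \<open>The coordinates \<open>1\<close>, \<open>2\<close>, \<open>k + 2\<close> and \<open>n + 1\<close> belong to \<open>g\<close>, \<open>h\<close>, \<open>c\<^sub>k\<close> and \<open>z\<close>. Giving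
  the bracket by coordinates rather than by a multiplication table spares a double sum in every computation.\<close>

definition F1_ext ::
  "nat \<Rightarrow> complex \<Rightarrow> complex \<Rightarrow> complex \<Rightarrow> complex \<Rightarrow> (nat \<Rightarrow> complex) calg" where
  "F1_ext n d p q r =
     \<lparr>space = {x. \<forall>i. i \<notin> {1..n + 1} \<longrightarrow> x i = 0},
      scl = cscale,
      brk = (\<lambda>x y k.
        if k = 3 then x 1 * y 2
        else if 4 \<le> k \<and> k \<le> n then x (k - 1) * y 2
        else if k = n + 1 then d * x n * y 2 + q * x 2 * y 1 + r * x 1 * y 1 - p * x 2 * y 2
        else 0)\<rparr>"

lemma F1_ext_iso_sym:
  assumes "n \<ge> 3" "alg_iso (F1_ext n d p q r) B" shows "alg_iso B (F1_ext n d p q r)"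
  by (rule alg_iso_sym[OF assms(2)]) (use assms(1) in \<open>auto simp: F1_ext_def cscale_def\<close>)

text \<open>The right-hand algebra is rewritten in the basis \<open>S g\<close>, \<open>A h + s c\<^sub>n\<^sub>-\<^sub>2\<close>, \<open>S A\<^sup>k c\<^sub>k\<close>, \<open>w z\<close>. The
  summand \<open>s c\<^sub>n\<^sub>-\<^sub>2\<close> contributes \<open>A s d z\<close> to the square of the second basis vector and nothing to any other product.\<close>

lemma F1_ext_rescale:
  assumes n: "n \<ge> 3" and nz: "S \<noteq> 0" "A \<noteq> 0" "w \<noteq> 0"
    and eqs: "w * d' = S * A ^ (n - 1) * d" "w * q' = A * S * q" "w * r' = S\<^sup>2 * r"
      "w * p' = A\<^sup>2 * p - A * s * d"
  shows "alg_iso (F1_ext n d' p' q' r') (F1_ext n d p q r)"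
proof -
  define f :: "(nat \<Rightarrow> complex) \<Rightarrow> nat \<Rightarrow> complex" where
    "f = (\<lambda>u k. if k = 1 then S * u 1 else if k = 2 then A * u 2
           else if k = n + 1 then w * u k
           else S * A ^ (k - 2) * u k + (if k = n then s * u 2 else 0))"
  define g :: "(nat \<Rightarrow> complex) \<Rightarrow> nat \<Rightarrow> complex" where
    "g = (\<lambda>u k. if k = 1 then u 1 / S else if k = 2 then u 2 / A
           else if k = n + 1 then u k / w
           else (u k - (if k = n then s * (u 2 / A) else 0)) / (S * A ^ (k - 2)))"
  have pn: "A ^ (n - 1) = A * A ^ (n - 2)"
    using n by (cases n; cases "n - 1") (auto simp: numeral_2_eq_2)
  have br: "f (brk (F1_ext n d' p' q' r') x y) = brk (F1_ext n d p q r) (f x) (f y)" for x y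
  proof
    fix k
    consider "k = n + 1" | "k = 3" | "4 \<le> k" "k \<le> n" | "k < 3" | "k > n + 1" using n by linarith
    then show "f (brk (F1_ext n d' p' q' r') x y) k = brk (F1_ext n d p q r) (f x) (f y) k"
    proof cases
      case 1
      have "w * (d' * x n * y 2 + q' * x 2 * y 1 + r' * x 1 * y 1 - p' * x 2 * y 2) =
            (w * d') * x n * y 2 + (w * q') * x 2 * y 1 + (w * r') * x 1 * y 1 - (w * p') * x 2 * y 2"
        by (simp add: algebra_simps)
      also have "\<dots> = d * (S * A ^ (n - 2) * x n + s * x 2) * (A * y 2) + q * (A * x 2) * (S * y 1)
          + r * (S * x 1) * (S * y 1) - p * (A * x 2) * (A * y 2)"
        unfolding eqs pn by (simp add: algebra_simps power2_eq_square)
      finally show ?thesis using 1 n by (simp add: f_def F1_ext_def)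
    next
      case 2 then show ?thesis using n by (simp add: f_def F1_ext_def)
    next
      case 3
      then obtain m where "k = m + 4" by (metis le_add_diff_inverse2)
      then show ?thesis using 3 by (simp add: f_def F1_ext_def eval_nat_numeral)
    next
      case 4 then show ?thesis using n by (auto simp: f_def F1_ext_def)
    next
      case 5 then show ?thesis using n by (auto simp: f_def F1_ext_def)
    qed
  qed
  have "alg_hom (F1_ext n d' p' q' r') (F1_ext n d p q r) f"
    unfolding alg_hom_def
  proof (intro conjI ballI allI)
    show "f ` space (F1_ext n d' p' q' r') \<subseteq> space (F1_ext n d p q r)"
      using n by (auto simp: f_def F1_ext_def)
  qed (use br in \<open>auto simp: f_def F1_ext_def cscale_def fun_eq_iff algebra_simps\<close>)
  moreover have "bij_betw f (space (F1_ext n d' p' q' r')) (space (F1_ext n d p q r))"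
    by (rule bij_betw_byWitness[where f' = g])
      (use n nz in \<open>auto simp: f_def g_def F1_ext_def fun_eq_iff\<close>)
  ultimately show ?thesis by (auto simp: alg_iso_def)
qed

section \<open>The multiplication tables in coordinates\<close>

text \<open>In all the tables only two basis vectors act nontrivially from the right. The coefficients of
  such a column are a shift \<open>e\<^sub>i \<mapsto> e\<^sub>i\<^sub>+\<^sub>1\<close> on an interval of indices plus finitely many single entries;
  the next lemmas sum these two kinds of contribution.\<close>

lemma brk_table_two_columns:
  assumes ab: "a \<in> {1..m}" "b \<in> {1..m}" "a \<noteq> b"
    and T: "\<And>i j. j \<noteq> a \<Longrightarrow> j \<noteq> b \<Longrightarrow> T i j = 0"
  shows "brk (table_algebra m T) x y k =
    (\<Sum>i\<in>{1..m}. x i * T i a k) * y a + (\<Sum>i\<in>{1..m}. x i * T i b k) * y b"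
proof -
  have "(\<Sum>j\<in>{1..m}. x i * y j * T i j k) = (\<Sum>j\<in>{a, b}. x i * y j * T i j k)" for i
    by (rule sum.mono_neutral_right) (use ab T in auto)
  then show ?thesis using ab(3)
    by (simp add: brk_table_algebra sum.distrib sum_distrib_left mult_ac)
qed

lemma sum_shift_column:
  fixes x :: "nat \<Rightarrow> complex"
  assumes "1 \<le> lo" "hi \<le> m"
  shows "(\<Sum>i\<in>{1..m}. x i * (if lo \<le> i \<and> i \<le> hi \<and> k = i + 1 then 1 else 0)) =
    (if lo + 1 \<le> k \<and> k \<le> hi + 1 then x (k - 1) else 0)"
proof -
  have "(\<Sum>i\<in>{1..m}. x i * (if lo \<le> i \<and> i \<le> hi \<and> k = i + 1 then 1 else 0)) =
    (\<Sum>i\<in>{1..m}. if i = k - 1 then if lo + 1 \<le> k \<and> k \<le> hi + 1 then x (k - 1) else 0 else 0)"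
    by (rule sum.cong) (use assms in auto)
  then show ?thesis using assms by (auto simp: sum.delta)
qed

lemma sum_single_column:
  fixes x :: "nat \<Rightarrow> complex"
  assumes "1 \<le> a" "a \<le> m"
  shows "(\<Sum>i\<in>{1..m}. x i * (if i = a \<and> P then c else 0)) = (if P then x a * c else 0)"
proof -
  have "(\<Sum>i\<in>{1..m}. x i * (if i = a \<and> P then c else 0)) =
     (\<Sum>i\<in>{1..m}. if i = a then if P then x a * c else 0 else 0)"
    by (rule sum.cong) auto
  then show ?thesis using assms by simp
qed

lemmas column_sums = distrib_left sum.distrib sum_shift_column sum_single_column

lemma brk_F1:
  assumes "n \<ge> 3"
  shows "brk (F1 n) x y k =
    (if k = 3 then (x 1 + x 2) * y 1 else if 4 \<le> k \<and> k \<le> n then x (k - 1) * y 1 else 0)"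
proof -
  let ?T = "\<lambda>(i::nat) (j::nat). if i = 1 \<and> j = 1 then bvec 3
     else if 2 \<le> i \<and> i \<le> n - 1 \<and> j = 1 then bvec (i + 1) else 0"
  have "?T i 1 k = (if i = 1 \<and> k = 3 then 1 else 0)
      + (if 2 \<le> i \<and> i \<le> n - 1 \<and> k = i + 1 then 1 else 0)" "?T i 2 k = 0" for i
    by (auto simp: bvec_def)
  note T = this
  have "brk (F1 n) x y k = (\<Sum>i\<in>{1..n}. x i * ?T i 1 k) * y 1 + (\<Sum>i\<in>{1..n}. x i * ?T i 2 k) * y 2"
    unfolding F1_def by (rule brk_table_two_columns) (use assms in auto)
  also have "\<dots> = ((if k = 3 then x 1 else 0) + (if 3 \<le> k \<and> k \<le> n then x (k - 1) else 0)) * y 1"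
    using assms by (simp only: T column_sums order_refl) auto
  finally show ?thesis using assms by (simp add: algebra_simps)
qed

lemma brk_Fext:
  assumes "n \<ge> 3"
  shows "brk (Fext (n + 1) a4 a3) x y k =
    (if k = 3 then (x 1 + x 2) * y 1 else if 4 \<le> k \<and> k \<le> n then x (k - 1) * y 1
     else if k = n + 1 then x n * y 1 + a3 * x 1 * y 2 + a4 * x 2 * y 2 else 0)"
proof -
  let ?T = "\<lambda>(i::nat) (j::nat). if i = 1 \<and> j = 1 then bvec 3
     else if 2 \<le> i \<and> i \<le> (n + 1) - 1 \<and> j = 1 then bvec (i + 1)
     else if i = 1 \<and> j = 2 then cscale a3 (bvec (n + 1))
     else if i = 2 \<and> j = 2 then cscale a4 (bvec (n + 1)) else 0"
  have "?T i 1 k = (if i = 1 \<and> k = 3 then 1 else 0)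
      + (if 2 \<le> i \<and> i \<le> n \<and> k = i + 1 then 1 else 0)"
    "?T i 2 k = (if i = 1 \<and> k = n + 1 then a3 else 0) + (if i = 2 \<and> k = n + 1 then a4 else 0)" for i
    by (auto simp: bvec_def cscale_def)
  note T = this
  have "brk (Fext (n + 1) a4 a3) x y k =
      (\<Sum>i\<in>{1..n + 1}. x i * ?T i 1 k) * y 1 + (\<Sum>i\<in>{1..n + 1}. x i * ?T i 2 k) * y 2"
    unfolding Fext_def by (rule brk_table_two_columns) (use assms in auto)
  also have "\<dots> = ((if k = 3 then x 1 else 0) + (if 3 \<le> k \<and> k \<le> n + 1 then x (k - 1) else 0)) * y 1
      + ((if k = n + 1 then x 1 * a3 else 0) + (if k = n + 1 then x 2 * a4 else 0)) * y 2"
    using assms by (simp only: T column_sums order_refl) auto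
  finally show ?thesis using assms by (simp add: algebra_simps)
qed

lemma brk_L5:
  assumes "n \<ge> 3"
  shows "brk (L5 (n + 1) lam mu) x y k =
    (if k = 2 then (x 1 + x n) * y 1 else if 3 \<le> k \<and> k \<le> n - 1 then x (k - 1) * y 1
     else if k = n + 1 then x n * y 1 + lam * x 1 * y n + mu * x n * y n else 0)"
proof -
  let ?m = "n + 1"
  let ?T = "\<lambda>(i::nat) (j::nat). if 1 \<le> i \<and> i \<le> ?m - 3 \<and> j = 1 then bvec (i + 1)
     else if i = ?m - 1 \<and> j = 1 then bvec ?m + bvec 2
     else if i = 1 \<and> j = ?m - 1 then cscale lam (bvec ?m)
     else if i = ?m - 1 \<and> j = ?m - 1 then cscale mu (bvec ?m) else 0"
  have "?T i 1 k = (if 1 \<le> i \<and> i \<le> n - 2 \<and> k = i + 1 then 1 else 0)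
      + (if i = n \<and> k = n + 1 then 1 else 0) + (if i = n \<and> k = 2 then 1 else 0)"
    "?T i n k = (if i = 1 \<and> k = n + 1 then lam else 0) + (if i = n \<and> k = n + 1 then mu else 0)" for i
    using assms by (auto simp: bvec_def cscale_def)
  note T = this
  have "brk (L5 (n + 1) lam mu) x y k =
      (\<Sum>i\<in>{1..n + 1}. x i * ?T i 1 k) * y 1 + (\<Sum>i\<in>{1..n + 1}. x i * ?T i n k) * y n"
    unfolding L5_def by (rule brk_table_two_columns) (use assms in auto)
  also have "\<dots> = ((if 2 \<le> k \<and> k \<le> n - 1 then x (k - 1) else 0) + (if k = n + 1 then x n else 0)
        + (if k = 2 then x n else 0)) * y 1
      + ((if k = n + 1 then x 1 * lam else 0) + (if k = n + 1 then x n * mu else 0)) * y n"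
    using assms by (simp only: T column_sums order_refl) auto
  finally show ?thesis using assms by (cases "k = 2"; cases "k = n + 1") (auto simp: algebra_simps)
qed

lemma brk_L1:
  assumes "n \<ge> 3"
  shows "brk (L1 (n + 1)) x y k =
    (if k = 2 then x 1 * (y 1 + y n) else if 3 \<le> k \<and> k \<le> n - 1 then x (k - 1) * (y 1 + y n)
     else if k = n + 1 then x 1 * y n else 0)"
proof -
  let ?m = "n + 1"
  let ?T = "\<lambda>(i::nat) (j::nat). if 1 \<le> i \<and> i \<le> ?m - 3 \<and> j = 1 then bvec (i + 1)
     else if i = 1 \<and> j = ?m - 1 then bvec ?m + bvec 2
     else if 2 \<le> i \<and> i \<le> ?m - 3 \<and> j = ?m - 1 then bvec (i + 1) else 0"
  have "?T i 1 k = (if 1 \<le> i \<and> i \<le> n - 2 \<and> k = i + 1 then 1 else 0)"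
    "?T i n k = (if i = 1 \<and> k = n + 1 then 1 else 0) + (if i = 1 \<and> k = 2 then 1 else 0)
      + (if 2 \<le> i \<and> i \<le> n - 2 \<and> k = i + 1 then 1 else 0)" for i
    using assms by (auto simp: bvec_def cscale_def)
  note T = this
  have "brk (L1 (n + 1)) x y k =
      (\<Sum>i\<in>{1..n + 1}. x i * ?T i 1 k) * y 1 + (\<Sum>i\<in>{1..n + 1}. x i * ?T i n k) * y n"
    unfolding L1_def by (rule brk_table_two_columns) (use assms in auto)
  also have "\<dots> = (if 2 \<le> k \<and> k \<le> n - 1 then x (k - 1) else 0) * y 1
      + ((if k = n + 1 then x 1 else 0) + (if k = 2 then x 1 else 0)
         + (if 3 \<le> k \<and> k \<le> n - 1 then x (k - 1) else 0)) * y n"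
    using assms by (simp only: T column_sums order_refl) auto
  finally show ?thesis using assms by (cases "k = 2"; cases "k = n + 1") (auto simp: algebra_simps)
qed

lemma L3_eq_L5: "m \<ge> 3 \<Longrightarrow> L3 m lam = L5 m lam 0"
  unfolding L3_def L5_def
  by (rule arg_cong[where f = "table_algebra m"]) (auto simp: fun_eq_iff cscale_def)

lemma L4_eq_L5: "m \<ge> 3 \<Longrightarrow> L4 m mu = L5 m 0 mu"
  unfolding L4_def L5_def
  by (rule arg_cong[where f = "table_algebra m"]) (auto simp: fun_eq_iff cscale_def)

section \<open>The listed algebras as members of the family\<close>

text \<open>Here \<open>g = e\<^sub>2\<close> and \<open>h = e\<^sub>1 - e\<^sub>2\<close>, so that \<open>c\<^sub>1 = [g,h] = e\<^sub>3 - \<alpha>\<^sub>4 e\<^sub>n\<^sub>+\<^sub>1\<close>; this correction of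
  \<open>c\<^sub>1\<close> is the reason for the coordinate 3 in the last component of the maps.\<close>

lemma F1_ext_iso_Fext:
  assumes n: "n \<ge> 3"
  shows "alg_iso (F1_ext n 1 (a3 - a4) (a3 - a4) a4) (Fext (n + 1) a4 a3)"
proof -
  let ?M = "F1_ext n 1 (a3 - a4) (a3 - a4) a4"
  define f :: "(nat \<Rightarrow> complex) \<Rightarrow> nat \<Rightarrow> complex" where
    "f = (\<lambda>u k. if k = 1 then u 2 else if k = 2 then u 1 - u 2
           else if k = n + 1 then u k - a4 * u 3 else u k)"
  define g :: "(nat \<Rightarrow> complex) \<Rightarrow> nat \<Rightarrow> complex" where
    "g = (\<lambda>v k. if k = 1 then v 1 + v 2 else if k = 2 then v 1
           else if k = n + 1 then v k + a4 * v 3 else v k)"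
  have br: "f (brk ?M x y) k = brk (Fext (n + 1) a4 a3) (f x) (f y) k" for x y k
  proof -
    consider "k = n + 1" | "k = 3" | "k = 4" "k \<le> n" | "5 \<le> k" "k \<le> n" | "k < 3" | "k > n + 1"
      using n by linarith
    then show ?thesis
      unfolding brk_Fext[OF n] using n by cases (auto simp: f_def F1_ext_def algebra_simps)
  qed
  have "alg_hom ?M (Fext (n + 1) a4 a3) f"
    unfolding alg_hom_def
  proof (intro conjI ballI allI)
    show "f ` space ?M \<subseteq> space (Fext (n + 1) a4 a3)"
      using n by (auto simp: f_def F1_ext_def Fext_def table_algebra_def)
  qed (use br in \<open>auto simp: f_def F1_ext_def cscale_def fun_eq_iff algebra_simps Fext_def table_algebra_def\<close>)
  moreover have "bij_betw f (space ?M) (space (Fext (n + 1) a4 a3))"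
    by (rule bij_betw_byWitness[where f' = g])
      (use n in \<open>auto simp: f_def g_def F1_ext_def fun_eq_iff Fext_def table_algebra_def\<close>)
  ultimately show ?thesis by (auto simp: alg_iso_def)
qed

text \<open>Here \<open>g = e\<^sub>n\<close> and \<open>h = e\<^sub>1 - e\<^sub>n\<close>, so that \<open>c\<^sub>1 = e\<^sub>2 + (1 - \<mu>) e\<^sub>n\<^sub>+\<^sub>1\<close> and \<open>c\<^sub>k = e\<^sub>k\<^sub>+\<^sub>1\<close> for
  \<open>k \<ge> 2\<close>. The families \<open>L3\<close> and \<open>L4\<close> are the cases \<open>\<mu> = 0\<close> and \<open>\<lambda> = 0\<close>.\<close>

lemma F1_ext_iso_L5:
  assumes n: "n \<ge> 3"
  shows "alg_iso (F1_ext n 0 (1 + lam - mu) (lam - mu) mu) (L5 (n + 1) lam mu)"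
proof -
  let ?M = "F1_ext n 0 (1 + lam - mu) (lam - mu) mu"
  define f :: "(nat \<Rightarrow> complex) \<Rightarrow> nat \<Rightarrow> complex" where
    "f = (\<lambda>u k. if k = 1 then u 2 else if k = n then u 1 - u 2
           else if k = n + 1 then u k + (1 - mu) * u 3
           else if 2 \<le> k \<and> k \<le> n - 1 then u (k + 1) else 0)"
  define g :: "(nat \<Rightarrow> complex) \<Rightarrow> nat \<Rightarrow> complex" where
    "g = (\<lambda>v k. if k = 1 then v 1 + v n else if k = 2 then v 1
           else if k = n + 1 then v k - (1 - mu) * v 2
           else if 3 \<le> k \<and> k \<le> n then v (k - 1) else 0)"
  have br: "f (brk ?M x y) k = brk (L5 (n + 1) lam mu) (f x) (f y) k" for x y k
  proof -
    consider "k = n + 1" | "k = n" | "k = 2" | "3 \<le> k" "k \<le> n - 1" | "k < 2" | "k > n + 1"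
      using n by linarith
    then show ?thesis
      unfolding brk_L5[OF n] using n by cases (auto simp: f_def F1_ext_def algebra_simps)
  qed
  have "alg_hom ?M (L5 (n + 1) lam mu) f"
    unfolding alg_hom_def
  proof (intro conjI ballI allI)
    show "f ` space ?M \<subseteq> space (L5 (n + 1) lam mu)"
      using n by (auto simp: f_def F1_ext_def L5_def table_algebra_def)
  qed (use br in \<open>auto simp: f_def F1_ext_def cscale_def fun_eq_iff algebra_simps L5_def table_algebra_def\<close>)
  moreover have "bij_betw f (space ?M) (space (L5 (n + 1) lam mu))"
    by (rule bij_betw_byWitness[where f' = g])
      (use n in \<open>auto simp: f_def g_def F1_ext_def fun_eq_iff L5_def table_algebra_def\<close>)
  ultimately show ?thesis by (auto simp: alg_iso_def)
qed

text \<open>Here \<open>g = e\<^sub>1 - e\<^sub>n\<close> and \<open>h = e\<^sub>n\<close>, because \<open>e\<^sub>1 - e\<^sub>n\<close> is the direction that acts trivially from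
  the right modulo \<open>e\<^sub>n\<^sub>+\<^sub>1\<close>; then \<open>c\<^sub>1 = e\<^sub>2 + e\<^sub>n\<^sub>+\<^sub>1\<close>.\<close>

lemma F1_ext_iso_L1:
  assumes n: "n \<ge> 3"
  shows "alg_iso (F1_ext n 0 0 0 (- 1)) (L1 (n + 1))"
proof -
  let ?M = "F1_ext n 0 0 0 (- 1)"
  define f :: "(nat \<Rightarrow> complex) \<Rightarrow> nat \<Rightarrow> complex" where
    "f = (\<lambda>u k. if k = 1 then u 1 else if k = n then u 2 - u 1
           else if k = n + 1 then u k + u 3
           else if 2 \<le> k \<and> k \<le> n - 1 then u (k + 1) else 0)"
  define g :: "(nat \<Rightarrow> complex) \<Rightarrow> nat \<Rightarrow> complex" where
    "g = (\<lambda>v k. if k = 1 then v 1 else if k = 2 then v 1 + v n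
           else if k = n + 1 then v k - v 2
           else if 3 \<le> k \<and> k \<le> n then v (k - 1) else 0)"
  have br: "f (brk ?M x y) k = brk (L1 (n + 1)) (f x) (f y) k" for x y k
  proof -
    consider "k = n + 1" | "k = n" | "k = 2" | "3 \<le> k" "k \<le> n - 1" | "k < 2" | "k > n + 1"
      using n by linarith
    then show ?thesis
      unfolding brk_L1[OF n] using n by cases (auto simp: f_def F1_ext_def algebra_simps)
  qed
  have "alg_hom ?M (L1 (n + 1)) f"
    unfolding alg_hom_def
  proof (intro conjI ballI allI)
    show "f ` space ?M \<subseteq> space (L1 (n + 1))"
      using n by (auto simp: f_def F1_ext_def L1_def table_algebra_def)
  qed (use br in \<open>auto simp: f_def F1_ext_def cscale_def fun_eq_iff algebra_simps L1_def table_algebra_def\<close>)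
  moreover have "bij_betw f (space ?M) (space (L1 (n + 1)))"
    by (rule bij_betw_byWitness[where f' = g])
      (use n in \<open>auto simp: f_def g_def F1_ext_def fun_eq_iff L1_def table_algebra_def\<close>)
  ultimately show ?thesis by (auto simp: alg_iso_def)
qed

lemma F1_ext_iso_split:
  assumes n: "n \<ge> 3"
  shows "alg_iso (F1_ext n 0 0 0 0) (alg_direct_sum (F1 n) abelian_line)"
proof -
  let ?M = "F1_ext n 0 0 0 0" and ?S = "alg_direct_sum (F1 n) abelian_line"
  define f :: "(nat \<Rightarrow> complex) \<Rightarrow> (nat \<Rightarrow> complex) \<times> complex" where
    "f = (\<lambda>u. (\<lambda>k. if k = 1 then u 2 else if k = 2 then u 1 - u 2
           else if k = n + 1 then 0 else u k, u (n + 1)))"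
  define g :: "(nat \<Rightarrow> complex) \<times> complex \<Rightarrow> nat \<Rightarrow> complex" where
    "g = (\<lambda>(v, t) k. if k = 1 then v 1 + v 2 else if k = 2 then v 1
           else if k = n + 1 then t else v k)"
  have br1: "fst (f (brk ?M x y)) k = brk (F1 n) (fst (f x)) (fst (f y)) k" for x y k
  proof -
    consider "k = n + 1" | "k = 3" | "k = 4" "k \<le> n" | "5 \<le> k" "k \<le> n" | "k < 3" | "k > n + 1"
      using n by linarith
    then show ?thesis
      unfolding brk_F1[OF n] using n by cases (auto simp: f_def F1_ext_def algebra_simps)
  qed
  have br: "f (brk ?M x y) = brk ?S (f x) (f y)" for x y
    by (rule prod_eqI)
      (use br1[of x y] n in \<open>auto simp: fun_eq_iff alg_direct_sum_def abelian_line_def f_def F1_ext_def\<close>)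
  have "alg_hom ?M ?S f"
    unfolding alg_hom_def
  proof (intro conjI ballI allI)
    show "f ` space ?M \<subseteq> space ?S"
      using n by (auto simp: f_def F1_ext_def F1_def table_algebra_def alg_direct_sum_def abelian_line_def)
  qed (use br in \<open>auto simp: f_def F1_ext_def cscale_def fun_eq_iff algebra_simps F1_def
        table_algebra_def alg_direct_sum_def abelian_line_def\<close>)
  moreover have "bij_betw f (space ?M) (space ?S)"
    by (rule bij_betw_byWitness[where f' = g])
      (use n in \<open>auto simp: f_def g_def F1_ext_def fun_eq_iff F1_def table_algebra_def
        alg_direct_sum_def abelian_line_def\<close>)
  ultimately show ?thesis by (auto simp: alg_iso_def)
qed

section \<open>Every extension belongs to the family\<close>

lemma additive_on_sum:
  fixes \<phi> :: "'a::ab_group_add \<Rightarrow> 'b::ab_group_add"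
  assumes "0 \<in> S" "\<And>x y. x \<in> S \<Longrightarrow> y \<in> S \<Longrightarrow> x + y \<in> S"
    and "\<And>x y. x \<in> S \<Longrightarrow> y \<in> S \<Longrightarrow> \<phi> (x + y) = \<phi> x + \<phi> y"
    and "\<And>k. k \<in> A \<Longrightarrow> t k \<in> S"
  shows "\<phi> (\<Sum>k\<in>A. t k) = (\<Sum>k\<in>A. \<phi> (t k)) \<and> (\<Sum>k\<in>A. t k) \<in> S"
proof -
  have "\<phi> 0 = 0" using assms(3)[of 0 0] assms(1) by simp
  then show ?thesis using assms(4)
    by (induction A rule: infinite_finite_induct) (use assms in auto)
qed

lemma one_dimensional_line:
  assumes V: "leibniz_algebra V" and dim: "alg_dim V = 1"
  obtains z where "z \<in> space V" "z \<noteq> 0" "\<And>x. x \<in> space V \<Longrightarrow> \<exists>c. x = scl V c z"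
proof -
  interpret V: vector_space "scl V" using V by (simp add: leibniz_algebra_def is_algebra_def)
  obtain B where B: "B \<subseteq> space V" "V.independent B" "space V \<subseteq> V.span B" "card B = 1"
    using V.basis_exists[of "space V"] dim unfolding alg_dim_def by metis
  then obtain z where z: "B = {z}" by (metis card_1_singletonE)
  then have "z \<noteq> 0" using B(2) V.dependent_single by blast
  moreover have "\<exists>c. x = scl V c z" if "x \<in> space V" for x
    using B(3) that z V.span_singleton by auto
  ultimately show ?thesis using that B(1) z by blast
qed

text \<open>Every product \<open>[x,g]\<close> lies in the kernel \<open>K\<close> of the projection, since \<open>g\<close> acts trivially from the right on
  the quotient; hence it is central. Expanding \<open>[x,[h,g]] = 0\<close> by the Leibniz identity then gives \<open>[[x,h],g] = 0\<close>,
  and with this the expansion of \<open>[x,[g,h]]\<close> gives \<open>[x,c\<^sub>1] = 0\<close>; induction extends it to all \<open>c\<^sub>k\<close>. So the products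
  of the basis \<open>g, h, c\<^sub>k, z\<close> are those of \<open>F1_ext\<close>. That these vectors form a basis follows by
  projecting to the quotient, where \<open>g, h, c\<^sub>k\<close> become a basis and \<open>z\<close> spans the kernel.\<close>

lemma central_extension_of_F1:
  assumes n: "n \<ge> 3" and ext: "central_extension 1 V \<iota> E \<pi> (F1 n)"
  shows "\<exists>d p q r. alg_iso (F1_ext n d p q r) E"
proof -
  have VL: "leibniz_algebra V" and EL: "leibniz_algebra E" and hV: "alg_hom V E \<iota>"
    and hE: "alg_hom E (F1 n) \<pi>" and inj: "inj_on \<iota> (space V)"
    and ker: "\<iota> ` space V = {x \<in> space E. \<pi> x = 0}" and onto: "\<pi> ` space E = space (F1 n)"
    and dim: "alg_dim V = 1" and cen: "\<iota> ` space V \<subseteq> alg_center E"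
    using ext by (auto simp: central_extension_def)
  interpret E: vector_space "scl E" using EL by (simp add: leibniz_algebra_def is_algebra_def)
  have sub: "E.subspace (space E)"
    using EL by (simp add: leibniz_algebra_def is_algebra_def)
  note S0 = E.subspace_0[OF sub] and Sadd = E.subspace_add[OF sub] and Sscl = E.subspace_scale[OF sub]
  have Sbrk: "x \<in> space E \<Longrightarrow> y \<in> space E \<Longrightarrow> brk E x y \<in> space E" for x y
    using EL by (simp add: leibniz_algebra_def is_algebra_def)
  have addl: "brk E (x + y) z = brk E x z + brk E y z" and addr: "brk E z (x + y) = brk E z x + brk E z y"
    if "x \<in> space E" "y \<in> space E" "z \<in> space E" for x y z
    using EL that by (simp_all add: leibniz_algebra_def is_algebra_def)
  have scll: "brk E (scl E c x) y = scl E c (brk E x y)" and sclr: "brk E x (scl E c y) = scl E c (brk E x y)"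
    if "x \<in> space E" "y \<in> space E" for c x y
    using EL that by (simp_all add: leibniz_algebra_def is_algebra_def)
  have leib: "brk E x (brk E y z) = brk E (brk E x y) z - brk E (brk E x z) y"
    if "x \<in> space E" "y \<in> space E" "z \<in> space E" for x y z
    using EL that by (simp add: leibniz_algebra_def)
  have zl: "brk E 0 y = 0" and zr: "brk E y 0 = 0" if "y \<in> space E" for y
    using scll[OF S0 that, of 0] sclr[OF that S0, of 0] by simp_all
  have piadd: "\<pi> (x + y) = \<pi> x + \<pi> y" and pibrk: "\<pi> (brk E x y) = brk (F1 n) (\<pi> x) (\<pi> y)"
    if "x \<in> space E" "y \<in> space E" for x y
    using hE that by (auto simp: alg_hom_def)
  have piscl: "\<pi> (scl E c x) = cscale c (\<pi> x)" if "x \<in> space E" for c x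
    using hE that by (auto simp: alg_hom_def F1_def table_algebra_def)
  have spF: "space (F1 n) = {x. \<forall>i. i \<notin> {1..n} \<longrightarrow> x i = 0}"
    by (simp add: F1_def table_algebra_def)
  define K where "K = {x \<in> space E. \<pi> x = 0}"
  have Kl: "brk E x y = 0" and Kr: "brk E y x = 0" if "x \<in> K" "y \<in> space E" for x y
    using cen that ker by (auto simp: K_def alg_center_def)
  obtain z0 where z0: "z0 \<in> space V" "z0 \<noteq> 0" "\<And>x. x \<in> space V \<Longrightarrow> \<exists>c. x = scl V c z0"
    using one_dimensional_line[OF VL dim] by blast
  define z where "z = \<iota> z0"
  have zK: "z \<in> K" using z0(1) ker by (auto simp: z_def K_def)
  then have zS: "z \<in> space E" "\<pi> z = 0" by (auto simp: K_def)
  have Kz: "\<exists>c. x = scl E c z" if "x \<in> K" for x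
  proof -
    have "x \<in> \<iota> ` space V" using that ker by (simp add: K_def)
    then obtain v where v: "v \<in> space V" "x = \<iota> v" by blast
    then obtain c where "v = scl V c z0" using z0(3) by blast
    then show ?thesis using hV v z0(1) by (auto simp: alg_hom_def z_def)
  qed
  have znz: "z \<noteq> 0"
  proof
    assume "z = 0"
    have "\<iota> (0 + 0) = \<iota> 0 + \<iota> 0"
      using hV VL unfolding alg_hom_def leibniz_algebra_def is_algebra_def
      by (metis module.subspace_0 module_iff_vector_space)
    then have "\<iota> 0 = \<iota> z0" using \<open>z = 0\<close> by (simp add: z_def)
    moreover have "0 \<in> space V"
      using VL unfolding leibniz_algebra_def is_algebra_def
      by (metis module.subspace_0 module_iff_vector_space)
    ultimately show False using inj z0 by (metis inj_onD)
  qed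
  have "bvec 2 \<in> space (F1 n)" "bvec 1 - bvec 2 \<in> space (F1 n)"
    using n by (auto simp: spF bvec_def)
  then obtain g h where g: "g \<in> space E" "\<pi> g = bvec 2" and h: "h \<in> space E" "\<pi> h = bvec 1 - bvec 2"
    using onto by (metis (no_types, lifting) imageE)
  have xg: "brk E x g \<in> K" if "x \<in> space E" for x
    using that g n by (auto simp: K_def Sbrk pibrk fun_eq_iff brk_F1 bvec_def)
  have xhg: "brk E (brk E x h) g = 0" if "x \<in> space E" for x
    using leib[OF that h(1) g(1)] Kr[OF xg[OF h(1)] that] Kl[OF xg[OF that] h(1)] by simp
  \<comment> \<open>Here the numbering starts with \<open>c 0 = g\<close>, so that basis vector \<open>k \<ge> 3\<close> is \<open>c (k - 2)\<close>; the value \<open>c (n - 1)\<close>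
    is the product \<open>[c\<^sub>n\<^sub>-\<^sub>2,h]\<close>, which projects to zero.\<close>
  define c where "c m = ((\<lambda>x. brk E x h) ^^ m) g" for m
  have c0: "c 0 = g" and cSuc: "c (Suc m) = brk E (c m) h" for m by (simp_all add: c_def)
  have cS: "c m \<in> space E" for m by (induction m) (simp_all add: c0 cSuc g h Sbrk)
  have pic: "\<pi> (c m) = (\<lambda>k. if k = m + 2 \<and> k \<le> n then 1 else 0)" for m
  proof (induction m)
    case 0
    then show ?case using n by (auto simp: c0 g bvec_def)
  next
    case (Suc m)
    then show ?case
      using n by (auto simp: cSuc pibrk cS h fun_eq_iff brk_F1 bvec_def)
  qed
  have xc: "brk E x (c (Suc m)) = 0" if "x \<in> space E" for x m
    using that
  proof (induction m arbitrary: x)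
    case 0
    then show ?case
      using leib[OF _ g(1) h(1)] xhg Kl[OF xg h(1)] by (simp add: cSuc c0)
  next
    case (Suc m)
    then have "brk E x (c (Suc m)) = 0" "brk E (brk E x h) (c (Suc m)) = 0"
      by (simp_all add: Sbrk h)
    then show ?case using leib[OF Suc.prems cS h(1)] zl[OF h(1)] by (simp add: cSuc[of "Suc m"])
  qed
  have cg: "brk E (c (Suc m)) g = 0" for m using xhg[OF cS] by (simp add: cSuc)
  have "c (n - 1) \<in> K" using cS pic[of "n - 1"] n by (auto simp: K_def fun_eq_iff)
  then obtain d where d: "c (n - 1) = scl E d z" using Kz by blast
  obtain q where q: "brk E h g = scl E q z" using Kz[OF xg[OF h(1)]] by blast
  obtain r where r: "brk E g g = scl E r z" using Kz[OF xg[OF g(1)]] by blast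
  have "brk E h h \<in> K"
    using h n by (auto simp: K_def Sbrk pibrk fun_eq_iff brk_F1 bvec_def)
  then obtain p' where p': "brk E h h = scl E p' z" using Kz by blast
  define p where "p = - p'"
  have p: "brk E h h = scl E (- p) z" using p' by (simp add: p_def)
  define cs where "cs u = (\<Sum>k\<in>{3..n}. scl E (u k) (c (k - 2)))" for u
  define F where "F u = scl E (u 1) g + scl E (u 2) h + cs u + scl E (u (n + 1)) z" for u
  have csS: "cs u \<in> space E" for u
    unfolding cs_def
    using additive_on_sum[of "space E" "\<lambda>x. x" "{3..n}" "\<lambda>k. scl E (u k) (c (k - 2))"] S0 Sadd Sscl cS by blast
  have FS: "F u \<in> space E" for u by (simp add: F_def Sadd Sscl g h zS csS)
  have cs_l: "brk E (cs u) x = (\<Sum>k\<in>{3..n}. scl E (u k) (brk E (c (k - 2)) x))" if "x \<in> space E" for u x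
    unfolding cs_def
    using additive_on_sum[of "space E" "\<lambda>y. brk E y x" "{3..n}" "\<lambda>k. scl E (u k) (c (k - 2))"]
      S0 Sadd Sscl cS addl scll that by simp
  have cs_r: "brk E x (cs u) = (\<Sum>k\<in>{3..n}. scl E (u k) (brk E x (c (k - 2))))" if "x \<in> space E" for u x
    unfolding cs_def
    using additive_on_sum[of "space E" "\<lambda>y. brk E x y" "{3..n}" "\<lambda>k. scl E (u k) (c (k - 2))"]
      S0 Sadd Sscl cS addr sclr that by simp
  have cs_pi: "\<pi> (cs u) = (\<Sum>k\<in>{3..n}. cscale (u k) (\<pi> (c (k - 2))))" for u
    unfolding cs_def
    using additive_on_sum[of "space E" \<pi> "{3..n}" "\<lambda>k. scl E (u k) (c (k - 2))"]
      S0 Sadd Sscl cS piadd piscl by simp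
  have Suc_c: "c (k - 2) = c (Suc (k - 3))" if "k \<ge> 3" for k
    using that by (metis Suc_diff_le diff_Suc_Suc eval_nat_numeral(3) numeral_2_eq_2)
  have xcs: "brk E x (cs u) = 0" if "x \<in> space E" for x u
    unfolding cs_r[OF that] by (rule sum.neutral) (use xc[OF that] Suc_c in auto)
  have csg: "brk E (cs u) g = 0" for u
    unfolding cs_l[OF g(1)] by (rule sum.neutral) (use cg Suc_c in auto)
  \<comment> \<open>Right multiplication by \<open>h\<close> shifts the chain \<open>g, c\<^sub>1, c\<^sub>2, \<dots>\<close>: \<open>f k u\<close> is the term that arrives at
    basis vector \<open>k\<close>, and it comes from \<open>g\<close> if \<open>k = 3\<close>.\<close>
  define f where "f k u = scl E (if k = 3 then u 1 else u (k - 1)) (c (k - 2))" for k and u :: "nat \<Rightarrow> complex"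
  have csh: "scl E (u 1) (brk E g h) + brk E (cs u) h = (\<Sum>k\<in>{3..n}. f k u) + scl E (d * u n) z" for u
  proof -
    have "brk E (cs u) h = (\<Sum>k\<in>{3..n}. f (Suc k) u)"
      unfolding cs_l[OF h(1)]
    proof (rule sum.cong)
      fix k assume "k \<in> {3..n}"
      then have "Suc k - 2 = Suc (k - 2)" by auto
      then show "scl E (u k) (brk E (c (k - 2)) h) = f (Suc k) u"
        using \<open>k \<in> {3..n}\<close> by (auto simp: f_def cSuc)
    qed simp
    also have "\<dots> = (\<Sum>k\<in>{4..Suc n}. f k u)"
      using sum.shift_bounds_cl_Suc_ivl[of "\<lambda>k. f k u" 3 n] by simp
    also have "\<dots> = (\<Sum>k\<in>{4..n}. f k u) + f (Suc n) u" using n by simp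
    also have "f (Suc n) u = scl E (d * u n) z"
    proof -
      have "Suc n - 2 = n - 1" using n by simp
      then show ?thesis using n d by (simp add: f_def mult.commute)
    qed
    finally have 1: "brk E (cs u) h = (\<Sum>k\<in>{4..n}. f k u) + scl E (d * u n) z" .
    have "(\<Sum>k\<in>{3..n}. f k u) = f 3 u + (\<Sum>k\<in>{4..n}. f k u)"
      using n by (simp add: sum.atLeast_Suc_atMost)
    moreover have "f 3 u = scl E (u 1) (brk E g h)" by (simp add: f_def cSuc c0)
    ultimately show ?thesis using 1 by simp
  qed
  let ?M = "F1_ext n d p q r"
  have brF: "brk E (F u) (F v) = F (brk ?M u v)" for u v
  proof -
    have gF: "brk E (F u) g = scl E (r * u 1 + q * u 2) z"
      by (simp add: F_def addl scll Sadd Sscl Sbrk g h zS csS csg r q Kl[OF zK] E.scale_left_distrib mult.commute)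
    have hF: "brk E (F u) h = (\<Sum>k\<in>{3..n}. f k u) + scl E (d * u n - p * u 2) z"
    proof -
      have "brk E (F u) h = scl E (u 1) (brk E g h) + scl E (u 2) (scl E (- p) z) + brk E (cs u) h"
        by (simp add: F_def addl scll Sadd Sscl Sbrk g h zS csS p Kl[OF zK])
      also have "\<dots> = (scl E (u 1) (brk E g h) + brk E (cs u) h) - scl E (p * u 2) z"
        by (simp add: mult.commute)
      finally show ?thesis unfolding csh by (simp add: E.scale_left_diff_distrib)
    qed
    have "brk E (F u) (F v) = scl E (v 1) (brk E (F u) g) + scl E (v 2) (brk E (F u) h)"
      by (subst (2) F_def) (simp add: addr sclr Sadd Sscl Sbrk g h zS csS FS xcs[OF FS] Kr[OF zK FS])
    also have "\<dots> = (\<Sum>k\<in>{3..n}. scl E (v 2) (f k u)) + scl E (v 1 * (r * u 1 + q * u 2) + v 2 * (d * u n - p * u 2)) z"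
      by (simp add: gF hF E.scale_right_distrib E.scale_left_distrib E.scale_sum_right distrib_left)
    also have "(\<Sum>k\<in>{3..n}. scl E (v 2) (f k u)) = cs (brk ?M u v)"
      unfolding cs_def by (rule sum.cong) (auto simp: f_def F1_ext_def mult.commute)
    also have "v 1 * (r * u 1 + q * u 2) + v 2 * (d * u n - p * u 2) = brk ?M u v (n + 1)"
      using n by (simp add: F1_ext_def algebra_simps)
    finally show ?thesis
      using n by (simp add: F_def F1_ext_def)
  qed
  have Fadd: "F (u + v) = F u + F v" for u v
    by (simp add: F_def cs_def E.scale_left_distrib sum.distrib)
  have Fscl: "F (cscale a u) = scl E a (F u)" for a u
    by (simp add: F_def cs_def cscale_def E.scale_right_distrib E.scale_sum_right)
  have hom: "alg_hom ?M E F"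
    unfolding alg_hom_def using FS Fadd Fscl brF by (auto simp: F1_ext_def)
  have piF: "\<pi> (F u) k = (if k = 1 then u 2 else if k = 2 then u 1 - u 2 else if 3 \<le> k \<and> k \<le> n then u k else 0)"
    for u k
  proof -
    have "\<pi> (cs u) k = (\<Sum>j\<in>{3..n}. if j = k then u k else 0)"
      unfolding cs_pi sum_fun_apply pic cscale_def by (rule sum.cong) auto
    then have "\<pi> (cs u) k = (if 3 \<le> k \<and> k \<le> n then u k else 0)" by simp
    then show ?thesis
      by (auto simp: F_def piadd piscl Sadd Sscl g h zS csS cscale_def bvec_def)
  qed
  have "inj_on F (space ?M)"
  proof (rule inj_onI)
    fix u v assume u: "u \<in> space ?M" and v: "v \<in> space ?M" and eq: "F u = F v"
    have low: "u k = v k" if "k \<noteq> n + 1" for k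
    proof -
      have "u 2 = v 2" "u 1 - u 2 = v 1 - v 2" "3 \<le> k \<Longrightarrow> k \<le> n \<Longrightarrow> u k = v k"
        using piF[of u 1] piF[of v 1] piF[of u 2] piF[of v 2] piF[of u k] piF[of v k] eq by auto
      then show ?thesis
        using u v that by (cases "k = 0 \<or> k > n"; cases "k = 1"; cases "k = 2") (auto simp: F1_ext_def)
    qed
    then have "cs u = cs v" unfolding cs_def by (intro sum.cong) auto
    moreover have "u 1 = v 1" "u 2 = v 2" using low[of 1] low[of 2] n by auto
    ultimately have "scl E (u (n + 1)) z = scl E (v (n + 1)) z" using eq unfolding F_def by simp
    then have "u (n + 1) = v (n + 1)" using znz by simp
    then have "u k = v k" for k using low by (cases "k = n + 1") auto
    then show "u = v" ..
  qed
  moreover have "F ` space ?M = space E"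
  proof
    show "F ` space ?M \<subseteq> space E" using FS by auto
    show "space E \<subseteq> F ` space ?M"
    proof
      fix x assume x: "x \<in> space E"
      define u where "u = (\<lambda>k. if k = 1 then \<pi> x 1 + \<pi> x 2 else if k = 2 then \<pi> x 1
        else if 3 \<le> k \<and> k \<le> n then \<pi> x k else 0)"
      have pix: "\<pi> x k = 0" if "k = 0 \<or> k > n" for k
      proof -
        have "\<pi> x \<in> space (F1 n)" using onto x by blast
        then show ?thesis using that by (auto simp: spF)
      qed
      have "\<pi> (F u) = \<pi> x"
      proof
        fix k
        consider "k = 1" | "k = 2" | "3 \<le> k \<and> k \<le> n" | "k = 0 \<or> k > n" by linarith
        then show "\<pi> (F u) k = \<pi> x k" using n by cases (auto simp: piF u_def pix)
      qed
      moreover have "\<pi> (x - F u + F u) = \<pi> (x - F u) + \<pi> (F u)"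
        using x FS by (intro piadd E.subspace_diff[OF sub]) auto
      ultimately have "x - F u \<in> K"
        using x FS by (simp add: K_def E.subspace_diff[OF sub])
      then obtain a where a: "x - F u = scl E a z" using Kz by blast
      have "F (u(n + 1 := a)) = F u + scl E a z"
      proof -
        have "cs (u(n + 1 := a)) = cs u" unfolding cs_def by (rule sum.cong) auto
        then show ?thesis using n by (simp add: F_def u_def)
      qed
      then have "x = F (u(n + 1 := a))" using a by (metis add.commute diff_add_cancel)
      moreover have "u(n + 1 := a) \<in> space ?M" using n by (auto simp: F1_ext_def u_def)
      ultimately show "x \<in> F ` space ?M" by blast
    qed
  qed
  ultimately show ?thesis using hom unfolding alg_iso_def bij_betw_def by blast
qed

section \<open>Orbits of the diagonal scalings\<close>

text \<open>The triples related by \<open>(p, q, r) \<mapsto> (A\<^sup>2 p, A S q, S\<^sup>2 r) / w\<close>, described by invariants: the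
  monomial \<open>p r / q\<^sup>2\<close> generates the invariants of the torus, and its equation is cleared of denominators.
  The next two lemmas show that the description is correct for nonzero triples.\<close>

definition same_torus_orbit where
  "same_torus_orbit p q r p' q' r' \<longleftrightarrow>
     (p = 0 \<longleftrightarrow> p' = 0) \<and> (q = 0 \<longleftrightarrow> q' = 0) \<and> (r = 0 \<longleftrightarrow> r' = 0) \<and>
     p * r * q'\<^sup>2 = p' * r' * q\<^sup>2" for p q r p' q' r' :: complex

lemma same_torus_orbitI:
  assumes "A \<noteq> 0" "S \<noteq> 0" "w \<noteq> 0"
    and "A\<^sup>2 * p' = w * p" "A * S * q' = w * q" "S\<^sup>2 * r' = w * r"
  shows "same_torus_orbit p q r p' q' r'"
proof -
  have "w\<^sup>2 * (A * S)\<^sup>2 * (p * r * q'\<^sup>2) = (w * p) * (w * r) * (A * S * q')\<^sup>2"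
    by (simp add: power2_eq_square algebra_simps)
  also have "\<dots> = (A\<^sup>2 * p') * (S\<^sup>2 * r') * (w * q)\<^sup>2" using assms by simp
  also have "\<dots> = w\<^sup>2 * (A * S)\<^sup>2 * (p' * r' * q\<^sup>2)"
    by (simp add: power2_eq_square algebra_simps)
  finally have "p * r * q'\<^sup>2 = p' * r' * q\<^sup>2" using assms(1-3) by simp
  then show ?thesis
    unfolding same_torus_orbit_def
    using assms(1-3) arg_cong[OF assms(4), of "\<lambda>v. v = 0"] arg_cong[OF assms(5), of "\<lambda>v. v = 0"]
      arg_cong[OF assms(6), of "\<lambda>v. v = 0"] by simp
qed

lemma same_torus_orbitE:
  assumes "same_torus_orbit p q r p' q' r'" "p \<noteq> 0 \<or> q \<noteq> 0 \<or> r \<noteq> 0"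
  obtains A S w where "A \<noteq> 0" "S \<noteq> 0" "w \<noteq> 0"
    "A\<^sup>2 * p = w * p'" "A * S * q = w * q'" "S\<^sup>2 * r = w * r'"
proof -
  note o = assms(1)[unfolded same_torus_orbit_def]
  consider "p \<noteq> 0" "q \<noteq> 0" | "p \<noteq> 0" "q = 0" "r \<noteq> 0" | "p \<noteq> 0" "q = 0" "r = 0"
    | "p = 0" "q \<noteq> 0" "r \<noteq> 0" | "p = 0" "q \<noteq> 0" "r = 0" | "p = 0" "q = 0" "r \<noteq> 0"
    using assms(2) by blast
  \<comment> \<open>In each case one of the three equations is solved for \<open>w\<close> and the remaining ones for \<open>A\<close> or \<open>S\<close>.\<close>
  then show ?thesis
  proof cases
    case 1
    have "(p * q' / (p' * q))\<^sup>2 * r = p * (p * r * q'\<^sup>2) / (p'\<^sup>2 * q\<^sup>2)"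
      by (simp add: power2_eq_square mult_ac)
    also have "p * r * q'\<^sup>2 = p' * r' * q\<^sup>2" using o by blast
    also have "p * (p' * r' * q\<^sup>2) / (p'\<^sup>2 * q\<^sup>2) = p / p' * r'" using o 1 by (simp add: power2_eq_square)
    finally have "(p * q' / (p' * q))\<^sup>2 * r = p / p' * r'" .
    moreover have "p' \<noteq> 0" "q' \<noteq> 0" using o 1 by blast+
    ultimately show ?thesis using 1 that[of 1 "p * q' / (p' * q)" "p / p'"] by simp
  next
    case 2
    moreover have "q' = 0" "p' \<noteq> 0" "r' \<noteq> 0" using o 2 by blast+
    ultimately show ?thesis using that[of 1 "csqrt (p / p' * r' / r)" "p / p'"] by simp
  next
    case 3
    moreover have "q' = 0" "r' = 0" "p' \<noteq> 0" using o 3 by blast+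
    ultimately show ?thesis using that[of 1 1 "p / p'"] by simp
  next
    case 4
    moreover have "p' = 0" "q' \<noteq> 0" "r' \<noteq> 0" using o 4 by blast+
    ultimately show ?thesis using that[of "r / r' * q' / q" 1 "r / r'"] by simp
  next
    case 5
    moreover have "p' = 0" "r' = 0" "q' \<noteq> 0" using o 5 by blast+
    ultimately show ?thesis using that[of 1 1 "q / q'"] by simp
  next
    case 6
    moreover have "p' = 0" "q' = 0" "r' \<noteq> 0" using o 6 by blast+
    ultimately show ?thesis using that[of 1 1 "r / r'"] by simp
  qed
qed

section \<open>Normal forms\<close>

lemma complex_root_exists:
  assumes "m \<ge> 1" "c \<noteq> (0::complex)"
  obtains a where "a \<noteq> 0" "a ^ m = c"
proof -
  have "(rcis (root m (cmod c)) (Arg c / m)) ^ m = c"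
    using assms by (simp add: DeMoivre2 rcis_cmod_Arg)
  then show ?thesis using that[of "rcis (root m (cmod c)) (Arg c / m)"] assms
    by (metis power_0_left not_one_le_zero)
qed

text \<open>The components are \<open>d, p, q, r\<close>, in this order.\<close>

fun entry_params :: "entry \<Rightarrow> complex \<times> complex \<times> complex \<times> complex" where
  "entry_params (EF a4 a3) = (1, a3 - a4, a3 - a4, a4)"
| "entry_params (EL3 lam) = (0, 1 + lam, lam, 0)"
| "entry_params (EL4 lam) = (0, 1 - lam, - lam, lam)"
| "entry_params (EL5 lam mu) = (0, 1 + lam - mu, lam - mu, mu)"
| "entry_params EL1 = (0, 0, 0, - 1)"

lemma F1_ext_iso_entry:
  assumes n: "n \<ge> 3" and s: "entry_params s = (d, p, q, r)"
  shows "alg_iso (F1_ext n d p q r) (entry_alg (n + 1) s)"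
proof (cases s)
  case (EF a4 a3)
  then show ?thesis using F1_ext_iso_Fext[OF n, of a3 a4] s by auto
next
  case (EL3 lam)
  then show ?thesis using F1_ext_iso_L5[OF n, of lam 0] L3_eq_L5[of "n + 1" lam] n s by auto
next
  case (EL4 lam)
  then show ?thesis using F1_ext_iso_L5[OF n, of 0 lam] L4_eq_L5[of "n + 1" lam] n s by auto
next
  case (EL5 lam mu)
  then show ?thesis using F1_ext_iso_L5[OF n, of lam mu] s by auto
next
  case EL1
  then show ?thesis using F1_ext_iso_L1[OF n] s by auto
qed

text \<open>For \<open>d \<noteq> 0\<close> the condition \<open>p = q\<close> satisfied by the algebras of type \<open>Fext\<close> is reached by the shift of \<open>h\<close>, and
  \<open>q\<close> is normalised by an \<open>(n - 2)\<close>-th root. For \<open>d = 0\<close> an orbit representative is read off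
  from the zero pattern of \<open>(p, q, r)\<close>; if no entry vanishes, \<open>L4\<close> with parameter \<open>\<lambda>\<close> has \<open>p r / q\<^sup>2 = (1 - \<lambda>) / \<lambda>\<close>,
  which takes every nonzero value except \<open>- 1\<close>, and \<open>L5\<close> with parameters \<open>2, 4\<close> supplies that one.\<close>

lemma F1_ext_normal_form:
  assumes n: "n \<ge> 3" and nz: "d \<noteq> 0 \<or> p \<noteq> 0 \<or> q \<noteq> 0 \<or> r \<noteq> 0"
  obtains s d' p' q' r' where "s \<in> entries" "entry_params s = (d', p', q', r')"
    "alg_iso (F1_ext n d' p' q' r') (F1_ext n d p q r)"
proof (cases "d = 0")
  case False
  have pn: "A ^ (n - 1) = A * A ^ (n - 2)" for A :: complex
    using n by (cases n; cases "n - 1") (auto simp: numeral_2_eq_2)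
  have rescale: "alg_iso (F1_ext n 1 e e r') (F1_ext n d p q r)"
    if "A \<noteq> 0" "S \<noteq> 0" "A ^ (n - 2) * d * e = q" "A ^ (n - 1) * d * r' = S * r" for A S e r'
    by (rule F1_ext_rescale[OF n, of S A "S * A ^ (n - 1) * d" _ _ _ _ _ _ _ _
          "(A\<^sup>2 * p - S * A ^ (n - 1) * d * e) / (A * d)"])
      (use that False in \<open>auto simp: pn[simplified] power2_eq_square mult_ac\<close>)
  have m: "1 \<le> n - 2" using n by simp
  consider "q = 0" "r = 0" | "q = 0" "r \<noteq> 0" | "q \<noteq> 0" "r = 0" | "q \<noteq> 0" "r \<noteq> 0" by blast
  then show ?thesis
  proof cases
    case 1
    then show ?thesis using rescale[of 1 1 0 0] that[of "EF 0 0"] by (simp add: entries_def)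
  next
    case 2
    then show ?thesis using rescale[of 1 "d / r" 0 1] that[of "EF 1 1"] False by (simp add: entries_def)
  next
    case 3
    then obtain A where "A \<noteq> 0" "A ^ (n - 2) = q / d"
      using complex_root_exists[of "n - 2" "q / d"] m False by (metis divide_eq_0_iff neg_equal_0_iff_equal)
    then show ?thesis using rescale[of A 1 1 0] that[of "EF 0 1"] 3 False by (simp add: entries_def)
  next
    case 4
    then obtain A where A: "A \<noteq> 0" "A ^ (n - 2) = - q / d"
      using complex_root_exists[of "n - 2" "- q / d"] m False by (metis divide_eq_0_iff neg_equal_0_iff_equal)
    then show ?thesis
      using rescale[of A "A ^ (n - 1) * d / r" "- 1" 1] that[of "EF 1 0"] 4 False by (simp add: entries_def)
  qed
next
  case True
  note normal_form = that
  have reduce: ?thesis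
    if s: "s \<in> entries" "entry_params s = (0, p', q', r')" and o: "same_torus_orbit p q r p' q' r'"
    for s p' q' r'
  proof -
    obtain A S w where "A \<noteq> 0" "S \<noteq> 0" "w \<noteq> 0"
      "A\<^sup>2 * p = w * p'" "A * S * q = w * q'" "S\<^sup>2 * r = w * r'"
      using same_torus_orbitE[OF o] nz True by blast
    then have "alg_iso (F1_ext n 0 p' q' r') (F1_ext n d p q r)"
      by (intro F1_ext_rescale[OF n, of S A w _ _ _ _ _ _ _ _ 0]) (simp_all add: True)
    then show ?thesis using normal_form s by blast
  qed
  consider "p \<noteq> 0" "q = 0" "r = 0" | "p \<noteq> 0" "q = 0" "r \<noteq> 0" | "p \<noteq> 0" "q \<noteq> 0" "r = 0"
    | "p \<noteq> 0" "q \<noteq> 0" "r \<noteq> 0" "p * r + q\<^sup>2 = 0" | "p \<noteq> 0" "q \<noteq> 0" "r \<noteq> 0" "p * r + q\<^sup>2 \<noteq> 0"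
    | "p = 0" "q \<noteq> 0" "r = 0" | "p = 0" "q \<noteq> 0" "r \<noteq> 0" | "p = 0" "q = 0" "r \<noteq> 0"
    using nz True by blast
  then show ?thesis
  proof cases
    case 1
    then show ?thesis using reduce[of "EL3 0" 1 0 0] by (simp add: entries_def same_torus_orbit_def)
  next
    case 2
    then show ?thesis using reduce[of "EL5 1 1" 1 0 1] by (simp add: entries_def same_torus_orbit_def)
  next
    case 3
    then show ?thesis using reduce[of "EL3 1" 2 1 0] by (simp add: entries_def same_torus_orbit_def)
  next
    case 4
    then have "p * r = - q\<^sup>2" by (simp add: eq_neg_iff_add_eq_0)
    then show ?thesis
      using 4 reduce[of "EL5 2 4" "- 1" "- 2" 4] by (simp add: entries_def same_torus_orbit_def)
  next
    case 5
    \<comment> \<open>the solution of \<open>(1 - \<lambda>) / \<lambda> = p r / q\<^sup>2\<close>\<close>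
    define lam where "lam = q\<^sup>2 / (p * r + q\<^sup>2)"
    have "lam \<noteq> 0" "1 - lam \<noteq> 0" "p * r * lam = (1 - lam) * q\<^sup>2"
      using 5 by (simp_all add: lam_def field_simps)
    then show ?thesis
      using 5 reduce[of "EL4 lam" "1 - lam" "- lam" lam]
      by (simp add: entries_def same_torus_orbit_def power2_eq_square mult_ac)
  next
    case 6
    then show ?thesis using reduce[of "EL3 (- 1)" 0 "- 1" 0] by (simp add: entries_def same_torus_orbit_def)
  next
    case 7
    then show ?thesis using reduce[of "EL4 1" 0 "- 1" 1] by (simp add: entries_def same_torus_orbit_def)
  next
    case 8
    then show ?thesis using reduce[of EL1 0 0 "- 1"] by (simp add: entries_def same_torus_orbit_def)
  qed
qed

section \<open>Isomorphisms within the family\<close>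

text \<open>Powers of right multiplication by \<open>y\<close> move \<open>x\<close> along the chain of the \<open>c\<^sub>k\<close>. Their leading coefficient involves
  only the \<open>g\<close>-component of \<open>x\<close> and the \<open>h\<close>-component of \<open>y\<close>, which makes these two components accessible to
  isomorphisms.\<close>

lemma right_mult_power:
  fixes d p q r :: complex and x y :: "nat \<Rightarrow> complex"
  assumes n: "n \<ge> 3" and j: "1 \<le> j" "j \<le> n - 2"
  defines "X \<equiv> ((\<lambda>v. brk (F1_ext n d p q r) v y) ^^ j) x"
  shows "k \<le> j + 1 \<Longrightarrow> X k = 0" and "X (j + 2) = y 2 ^ j * x 1"
proof -
  have "(\<forall>k\<le>j + 1. ((\<lambda>v. brk (F1_ext n d p q r) v y) ^^ j) x k = 0) \<and>
      ((\<lambda>v. brk (F1_ext n d p q r) v y) ^^ j) x (j + 2) = y 2 ^ j * x 1"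
    using j
  proof (induction j rule: nat_induct_at_least)
    case base
    then show ?case using n by (auto simp: F1_ext_def)
  next
    case (Suc j)
    define v where "v = ((\<lambda>v. brk (F1_ext n d p q r) v y) ^^ j) x"
    have v: "v k = 0" if "k \<le> j + 1" for k using Suc that by (simp add: v_def)
    have v': "v (j + 2) = y 2 ^ j * x 1" using Suc by (simp add: v_def)
    have "((\<lambda>v. brk (F1_ext n d p q r) v y) ^^ Suc j) x = brk (F1_ext n d p q r) v y"
      by (simp add: v_def)
    then show ?case using v v' Suc.prems Suc.hyps by (auto simp: F1_ext_def)
  qed
  then show "k \<le> j + 1 \<Longrightarrow> X k = 0" "X (j + 2) = y 2 ^ j * x 1" by (auto simp: X_def)
qed

lemma right_mult_power_top:
  assumes n: "n \<ge> 3"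
  shows "((\<lambda>v. brk (F1_ext n d p q r) v y) ^^ (n - 1)) x
    = cscale (d * (y 2 ^ (n - 1) * x 1)) (bvec (n + 1))"
proof -
  define v where "v = ((\<lambda>v. brk (F1_ext n d p q r) v y) ^^ (n - 2)) x"
  have v: "v k = 0" if "k \<le> n - 1" for k
    using right_mult_power(1)[of n "n - 2" k d p q r y x] n that by (simp add: v_def)
  have v': "v n = y 2 ^ (n - 2) * x 1"
  proof -
    have "n - 2 + 2 = n" using n by simp
    then show ?thesis using right_mult_power(2)[of n "n - 2" d p q r y x] n by (simp add: v_def)
  qed
  have "n - 1 = Suc (n - 2)" using n by simp
  then have "((\<lambda>v. brk (F1_ext n d p q r) v y) ^^ (n - 1)) x = brk (F1_ext n d p q r) v y"
    and "y 2 ^ (n - 1) = y 2 ^ (n - 2) * y 2" by (simp_all add: v_def)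
  then show ?thesis
    using n v' by (auto simp: F1_ext_def fun_eq_iff cscale_def bvec_def v)
qed

lemma right_mult_power_top_nilpotent:
  assumes n: "n \<ge> 4"
  shows "((\<lambda>v. brk (F1_ext n 0 p q r) v y) ^^ (n - 2)) x = cscale (y 2 ^ (n - 2) * x 1) (bvec n)"
proof -
  define v where "v = ((\<lambda>v. brk (F1_ext n 0 p q r) v y) ^^ (n - 3)) x"
  have v: "v k = 0" if "k \<le> n - 2" for k
    using right_mult_power(1)[of n "n - 3" k 0 p q r y x] n that by (simp add: v_def)
  have v': "v (n - 1) = y 2 ^ (n - 3) * x 1"
  proof -
    have "n - 3 + 2 = n - 1" using n by simp
    then show ?thesis using right_mult_power(2)[of n "n - 3" 0 p q r y x] n by (simp add: v_def)
  qed
  have "n - 2 = Suc (n - 3)" using n by simp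
  then have "((\<lambda>v. brk (F1_ext n 0 p q r) v y) ^^ (n - 2)) x = brk (F1_ext n 0 p q r) v y"
    and "y 2 ^ (n - 2) = y 2 ^ (n - 3) * y 2" by (simp_all add: v_def)
  then show ?thesis
    using n v' by (auto simp: F1_ext_def fun_eq_iff cscale_def bvec_def v)
qed

text \<open>Let \<open>x, y\<close> be the images of \<open>g, h\<close>. The longest power of right multiplication by \<open>h\<close> that does not kill \<open>g\<close> has
  a nonzero image, so the \<open>g\<close>-component of \<open>x\<close> and the \<open>h\<close>-component of \<open>y\<close> are nonzero. The relations
  \<open>[[g,h],g] = 0\<close> and \<open>[[h,h],h] = 0\<close> then make the other two components vanish: the hypothesis ensures that
  \<open>c\<^sub>2\<close> in the target, or \<open>d' z\<close> in its place for \<open>n = 3\<close>, is nonzero. Comparing the coefficients of \<open>z\<close> in the images of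
  \<open>[g,g]\<close>, \<open>[h,g]\<close> and \<open>[h,h]\<close> gives the equations.\<close>

lemma F1_ext_iso_diagonal:
  assumes n: "n \<ge> 3" and iso: "alg_iso (F1_ext n d p q r) (F1_ext n d' p' q' r')"
    and cs: "(d \<noteq> 0 \<and> d' \<noteq> 0) \<or> (n \<ge> 4 \<and> d = 0 \<and> d' = 0)"
  obtains A S w where "A \<noteq> 0" "S \<noteq> 0" "A * S * q' = w * q" "S\<^sup>2 * r' = w * r"
    "d = 0 \<longrightarrow> A\<^sup>2 * p' = w * p" "d \<noteq> 0 \<longrightarrow> w \<noteq> 0"
proof -
  let ?M = "F1_ext n d p q r" and ?N = "F1_ext n d' p' q' r'"
  obtain f where hom: "alg_hom ?M ?N f" and inj: "inj_on f (space ?M)"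
    using iso by (auto simp: alg_iso_def bij_betw_def)
  have scM: "scl ?M = cscale" "scl ?N = cscale" by (simp_all add: F1_ext_def)
  have fb: "f (brk ?M u v) = brk ?N (f u) (f v)" if "u \<in> space ?M" "v \<in> space ?M" for u v
    using hom that by (simp add: alg_hom_def)
  have fs: "f (cscale c u) = cscale c (f u)" if "u \<in> space ?M" for c u
    using hom that by (simp add: alg_hom_def scM)
  have cl: "brk ?M u v \<in> space ?M" for u v using n by (auto simp: F1_ext_def)
  let ?g = "bvec 1" and ?h = "bvec 2" and ?z = "bvec (n + 1)"
  have S: "?g \<in> space ?M" "?h \<in> space ?M" "?z \<in> space ?M" "bvec n \<in> space ?M" "0 \<in> space ?M"
    using n by (auto simp: F1_ext_def bvec_def)
  have cs0: "cscale 0 u = 0" for u by (auto simp: cscale_def fun_eq_iff)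
  have f0: "f 0 = 0" using fs[OF S(5), of 0] cs0 by simp
  have fnz: "f u \<noteq> 0" if "u \<in> space ?M" "u \<noteq> 0" for u using inj f0 S(5) that by (metis inj_onD)
  define x y w where "x = f ?g" and "y = f ?h" and "w = f ?z (n + 1)"
  have fit: "f (((\<lambda>v. brk ?M v ?h) ^^ j) ?g) = ((\<lambda>v. brk ?N v y) ^^ j) x
      \<and> ((\<lambda>v. brk ?M v ?h) ^^ j) ?g \<in> space ?M" for j
    by (induction j) (simp_all add: S S[simplified] x_def fb cl y_def)
  have top: "x 1 \<noteq> 0 \<and> y 2 \<noteq> 0 \<and> (d \<noteq> 0 \<longrightarrow> w \<noteq> 0)"
  proof (cases "d = 0")
    case True
    then have "n \<ge> 4" "d' = 0" using cs by auto
    have "((\<lambda>v. brk ?M v ?h) ^^ (n - 2)) ?g = bvec n"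
      unfolding True right_mult_power_top_nilpotent[OF \<open>n \<ge> 4\<close>] by (simp add: bvec_def cscale_def)
    then have bn: "f (bvec n) = cscale (y 2 ^ (n - 2) * x 1) (bvec n)"
      using fit[of "n - 2"] right_mult_power_top_nilpotent[OF \<open>n \<ge> 4\<close>] True \<open>d' = 0\<close>
      by simp
    have "bvec n \<noteq> 0" by (auto simp: bvec_def fun_eq_iff)
    then have "y 2 ^ (n - 2) * x 1 \<noteq> 0" using fnz[OF S(4)] bn cs0 by metis
    then show ?thesis using n True by auto
  next
    case False
    then have "d' \<noteq> 0" using cs by auto
    have "((\<lambda>v. brk ?M v ?h) ^^ (n - 1)) ?g = cscale d ?z"
      unfolding right_mult_power_top[OF n] by (simp add: bvec_def)
    then have bz: "cscale d (f ?z) = cscale (d' * (y 2 ^ (n - 1) * x 1)) ?z"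
      using fit[of "n - 1"] fs[OF S(3)] unfolding right_mult_power_top[OF n] by simp
    have "?z \<noteq> 0" by (auto simp: bvec_def fun_eq_iff)
    then have "f ?z \<noteq> 0" using fnz S by blast
    then have "cscale d (f ?z) \<noteq> 0" using False by (auto simp: cscale_def fun_eq_iff)
    then have nz: "d' * (y 2 ^ (n - 1) * x 1) \<noteq> 0" using bz cs0 by metis
    moreover have "d * w = d' * (y 2 ^ (n - 1) * x 1)"
      using fun_cong[OF bz, of "n + 1"] by (simp add: cscale_def bvec_def w_def)
    ultimately have "w \<noteq> 0" by auto
    then show ?thesis using nz n by auto
  qed
  \<comment> \<open>Coordinate 4 is that of \<open>c\<^sub>2\<close> if \<open>n \<ge> 4\<close> and that of \<open>z\<close> if \<open>n = 3\<close>.\<close>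
  have "brk ?M (brk ?M ?g ?h) ?g = 0" "brk ?M (brk ?M ?h ?h) ?h = 0"
    using n by (auto simp: F1_ext_def bvec_def fun_eq_iff)
  then have "brk ?N (brk ?N x y) x = 0" "brk ?N (brk ?N y y) y = 0"
    using fb S cl f0 by (metis x_def y_def)+
  then have "brk ?N (brk ?N x y) x 4 = 0" "brk ?N (brk ?N y y) y 4 = 0" by simp_all
  then have x2: "x 2 = 0" and y1: "y 1 = 0" using n cs top by (auto simp: F1_ext_def split: if_splits)
  have "brk ?M ?g ?g = cscale r ?z" "brk ?M ?h ?g = cscale q ?z" "brk ?M ?h ?h = cscale (- p) ?z"
    using n by (auto simp: F1_ext_def bvec_def fun_eq_iff cscale_def)
  then have "brk ?N x x = cscale r (f ?z)" "brk ?N y x = cscale q (f ?z)" "brk ?N y y = cscale (- p) (f ?z)"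
    using fb S fs by (metis x_def y_def)+
  then have "brk ?N x x (n + 1) = r * w" "brk ?N y x (n + 1) = q * w" "brk ?N y y (n + 1) = - p * w"
    by (simp_all add: cscale_def w_def)
  then have "(x 1)\<^sup>2 * r' = w * r" "y 2 * x 1 * q' = w * q" "d = 0 \<longrightarrow> (y 2)\<^sup>2 * p' = w * p"
    using n x2 y1 cs by (auto simp: F1_ext_def power2_eq_square mult_ac)
  then show ?thesis using that[of "y 2" "x 1" w] top by blast
qed

text \<open>The \<open>(n - 1)\<close>-st power of right multiplication by \<open>h\<close> sends \<open>g\<close> to \<open>d z\<close>, whereas all such powers vanish
  in the target.\<close>

lemma F1_ext_iso_mixed:
  assumes n: "n \<ge> 3" and iso: "alg_iso (F1_ext n d p q r) (F1_ext n 0 p' q' r')"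
  shows "d = 0"
proof -
  let ?M = "F1_ext n d p q r" and ?N = "F1_ext n 0 p' q' r'"
  obtain f where hom: "alg_hom ?M ?N f" and inj: "inj_on f (space ?M)"
    using iso by (auto simp: alg_iso_def bij_betw_def)
  have S: "bvec 1 \<in> space ?M" "bvec 2 \<in> space ?M" "0 \<in> space ?M"
    using n by (auto simp: F1_ext_def bvec_def)
  have cl: "brk ?M u v \<in> space ?M" for u v using n by (auto simp: F1_ext_def)
  have fb: "f (brk ?M u v) = brk ?N (f u) (f v)" if "u \<in> space ?M" "v \<in> space ?M" for u v
    using hom that by (simp add: alg_hom_def)
  have f0: "f 0 = 0"
  proof -
    have "f (0 + 0) = f 0 + f 0" using hom S(3) unfolding alg_hom_def by blast
    then show ?thesis by simp
  qed
  let ?u = "((\<lambda>v. brk ?M v (bvec 2)) ^^ (n - 1)) (bvec 1)"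
  have fit: "f (((\<lambda>v. brk ?M v (bvec 2)) ^^ j) (bvec 1)) = ((\<lambda>v. brk ?N v (f (bvec 2))) ^^ j) (f (bvec 1))
      \<and> ((\<lambda>v. brk ?M v (bvec 2)) ^^ j) (bvec 1) \<in> space ?M" for j
    by (induction j) (simp_all add: S S[simplified] fb cl)
  have "f ?u = 0"
    using fit[of "n - 1"] right_mult_power_top[OF n, of 0]
    by (auto simp: cscale_def fun_eq_iff)
  then have "?u = 0" using inj fit f0 S(3) by (metis inj_onD)
  then have "?u (n + 1) = 0" by simp
  then show ?thesis
    unfolding right_mult_power_top[OF n] by (simp add: cscale_def bvec_def)
qed

text \<open>For \<open>n = 3\<close> and \<open>d = 0\<close> the bracket is a pair of bilinear forms on the plane spanned by \<open>g, h\<close>, namely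
  \<open>G \<otimes> H\<close> as \<open>c\<^sub>1\<close>-component and \<open>q H \<otimes> G + r G \<otimes> G - p H \<otimes> H\<close> as \<open>z\<close>-component, where \<open>G, H\<close> is the dual basis.
  The form \<open>G \<otimes> H\<close> is degenerate, and for \<open>q \<noteq> 0\<close> the pencil spanned by the two contains
  exactly one more degenerate form, up to scalars: \<open>(q H + r G) \<otimes> (q G - p H)\<close>. Its factors are independent,
  like those of \<open>G \<otimes> H\<close>, if and only if \<open>p r + q\<^sup>2 \<noteq> 0\<close>, and then an isomorphism may exchange the two forms. The exchange preserves \<open>p r / q\<^sup>2\<close> but interchanges the coincidences \<open>p = 0\<close> (the left factor
  of \<open>G \<otimes> H\<close> is proportional to the right factor of the other form) and \<open>r = 0\<close> (the right factor of \<open>G \<otimes> H\<close> is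
  proportional to the left factor of the other form).\<close>

definition swapped_torus_orbit where
  "swapped_torus_orbit p q r p' q' r' \<longleftrightarrow>
     q \<noteq> 0 \<and> q' \<noteq> 0 \<and> (p' = 0 \<longleftrightarrow> r = 0) \<and> (r' = 0 \<longleftrightarrow> p = 0) \<and>
     p * r * q'\<^sup>2 = p' * r' * q\<^sup>2" for p q r p' q' r' :: complex

text \<open>The images \<open>x, y\<close> of \<open>g, h\<close> have components \<open>x1, x2\<close> and \<open>y1, y2\<close>, and \<open>w3, w4\<close> are the components of the image
  of \<open>z\<close>. If \<open>w3 = 0\<close>, the form \<open>G \<otimes> H\<close> is preserved and the change of basis is diagonal. Otherwise the
  form \<open>G \<otimes> H\<close> of the target is pulled back to a different degenerate form of the source: for \<open>q \<noteq> 0\<close> this is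
  the exchange, and for \<open>q = 0\<close> the pencil is so degenerate that both triples have a single
  nonzero entry, in the same place.\<close>

lemma pencil_equivalence:
  fixes p q r p' q' r' x1 x2 y1 y2 w3 w4 :: complex
  assumes det: "x1 * y2 \<noteq> x2 * y1" and nz: "p' \<noteq> 0 \<or> q' \<noteq> 0 \<or> r' \<noteq> 0"
    and e1: "x1 * x2 = r * w3" and e2: "y1 * x2 = q * w3" and e3: "y1 * y2 = - p * w3"
    and z1: "q' * x2 * x1 + r' * x1 * x1 - p' * x2 * x2 = r * w4"
    and z2: "q' * y2 * x1 + r' * y1 * x1 - p' * y2 * x2 = q * w4"
    and z3: "q' * y2 * y1 + r' * y1 * y1 - p' * y2 * y2 = - p * w4"
  shows "same_torus_orbit p q r p' q' r' \<or> swapped_torus_orbit p q r p' q' r'"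
proof -
  have diag: ?thesis if "x2 = 0" "y1 = 0"
  proof -
    have "x1 \<noteq> 0" "y2 \<noteq> 0" using det that by auto
    moreover have "w4 \<noteq> 0" using nz z1 z2 z3 that calculation by auto
    ultimately show ?thesis
      using z1 z2 z3 that same_torus_orbitI[of y2 x1 w4 p' p q' q r' r]
      by (auto simp: power2_eq_square mult_ac)
  qed
  consider "w3 = 0" | "w3 \<noteq> 0" "q = 0" | "w3 \<noteq> 0" "q \<noteq> 0" by blast
  then show ?thesis
  proof cases
    case 1
    then have "x1 * x2 = 0" "y1 * x2 = 0" "y1 * y2 = 0" using e1 e2 e3 by simp_all
    then have "x2 = 0" "y1 = 0" using det by auto
    then show ?thesis by (rule diag)
  next
    case 2
    then have "y1 * x2 = 0" using e2 by simp
    then consider "x2 = 0" "y1 = 0" | "x2 = 0" "y1 \<noteq> 0" | "x2 \<noteq> 0" "y1 = 0" by auto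
    then show ?thesis
    proof cases
      case 1
      then show ?thesis by (rule diag)
    next
      case x: 2
      then have "x1 \<noteq> 0" "y2 \<noteq> 0" using det by auto
      then show ?thesis using x 2 e1 e3 z1 z2 nz by (auto simp: same_torus_orbit_def)
    next
      case x: 3
      then have "x1 \<noteq> 0" "y2 \<noteq> 0" using det by auto
      then show ?thesis using x 2 e1 e3 z2 z3 nz by (auto simp: same_torus_orbit_def)
    qed
  next
    case 3
    then have nz2: "x2 \<noteq> 0" "y1 \<noteq> 0" using e2 by auto
    \<comment> \<open>The equations for the \<open>c\<^sub>1\<close>-components determine \<open>x1, y2\<close> from \<open>x2, y1\<close>; eliminating \<open>w4\<close> from the equations for
      the \<open>z\<close>-components then gives two linear relations between \<open>x2\<close> and \<open>y1\<close>, up to the factor \<open>r p + q\<^sup>2\<close>, which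
      is nonzero because the determinant is.\<close>
    have "x2 * (q * x1 - r * y1) = 0" using e1 e2 by algebra
    then have hx: "q * x1 = r * y1" using nz2 by simp
    have "y1 * (q * y2 + p * x2) = 0" using e2 e3 by algebra
    then have hy: "q * y2 = - (p * x2)" using nz2 by (simp add: add_eq_0_iff)
    have "q\<^sup>2 * (x1 * y2 - x2 * y1) = - (x2 * y1 * (r * p + q\<^sup>2))" using hx hy by algebra
    moreover have "q\<^sup>2 * (x1 * y2 - x2 * y1) \<noteq> 0" using det 3 by simp
    ultimately have D: "r * p + q\<^sup>2 \<noteq> 0" by auto
    have "(r * p + q\<^sup>2) * x2 * (q' * r * y1 - p' * q * x2) = 0"
      using z1 z2 hx hy by algebra
    then have I: "p' * q * x2 = q' * r * y1" using D nz2 by simp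
    have "(r * p + q\<^sup>2) * y1 * (r' * q * y1 - p * q' * x2) = 0"
      using z2 z3 hx hy by algebra
    then have II: "r' * q * y1 = p * q' * x2" using D nz2 by simp
    have "q' \<noteq> 0" using I II nz nz2 3 by auto
    moreover have "p' = 0 \<longleftrightarrow> r = 0" "r' = 0 \<longleftrightarrow> p = 0"
      using arg_cong[OF I, of "\<lambda>v. v = 0"] arg_cong[OF II, of "\<lambda>v. v = 0"] calculation nz2 3
      by simp_all
    moreover have "x2 * y1 * (p * r * q'\<^sup>2 - p' * r' * q\<^sup>2) = 0" using I II by algebra
    then have "p * r * q'\<^sup>2 = p' * r' * q\<^sup>2" using nz2 by simp
    ultimately show ?thesis using 3 unfolding swapped_torus_orbit_def by blast
  qed
qed

lemma F1_ext_iso_dim4: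
  assumes iso: "alg_iso (F1_ext 3 0 p q r) (F1_ext 3 0 p' q' r')"
    and nz: "p' \<noteq> 0 \<or> q' \<noteq> 0 \<or> r' \<noteq> 0"
  shows "same_torus_orbit p q r p' q' r' \<or> swapped_torus_orbit p q r p' q' r'"
proof -
  let ?M = "F1_ext 3 0 p q r" and ?N = "F1_ext 3 0 p' q' r'"
  obtain f where hom: "alg_hom ?M ?N f" and inj: "inj_on f (space ?M)"
    using iso by (auto simp: alg_iso_def bij_betw_def)
  have scM: "scl ?M = cscale" "scl ?N = cscale" by (simp_all add: F1_ext_def)
  have fb: "f (brk ?M u v) = brk ?N (f u) (f v)" if "u \<in> space ?M" "v \<in> space ?M" for u v
    using hom that by (simp add: alg_hom_def)
  have fs: "f (cscale c u) = cscale c (f u)" if "u \<in> space ?M" for c u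
    using hom that by (simp add: alg_hom_def scM)
  have fa: "f (u + v) = f u + f v" if "u \<in> space ?M" "v \<in> space ?M" for u v
    using hom that by (simp add: alg_hom_def)
  have brM: "brk (F1_ext 3 0 p q r) u v = (\<lambda>k. if k = 3 then u 1 * v 2
      else if k = 4 then q * u 2 * v 1 + r * u 1 * v 1 - p * u 2 * v 2 else 0)" for p q r u v
    by (auto simp: F1_ext_def fun_eq_iff)
  have cl: "brk ?M u v \<in> space ?M" for u v by (auto simp: F1_ext_def)
  let ?g = "bvec 1" and ?h = "bvec 2" and ?z = "bvec 4"
  have S: "?g \<in> space ?M" "?h \<in> space ?M" "?z \<in> space ?M" "0 \<in> space ?M"
    by (auto simp: F1_ext_def bvec_def)
  have f0: "f 0 = 0" using fa[OF S(4) S(4)] by simp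
  \<comment> \<open>Vectors without \<open>g\<close>- and \<open>h\<close>-component are central, and \<open>v\<close> can be central only if it has none either. This is
    what makes the matrix of the induced map on the plane invertible.\<close>
  have central: "v 1 = 0 \<and> v 2 = 0" if v: "v \<in> space ?M" "f v 1 = 0" "f v 2 = 0" for v
  proof -
    have "brk ?N (f v) u = 0" "brk ?N u (f v) = 0" for u using v by (auto simp: brM fun_eq_iff)
    then have "f (brk ?M v ?h) = f 0" "f (brk ?M ?g v) = f 0" using fb v S f0 by simp_all
    then have "brk ?M v ?h = 0" "brk ?M ?g v = 0" using inj cl S(4) by (auto dest: inj_onD)
    then have "brk ?M v ?h 3 = 0" "brk ?M ?g v 3 = 0" by simp_all
    then show ?thesis by (simp add: brM bvec_def)
  qed
  define x y w where "x = f ?g" and "y = f ?h" and "w = f ?z"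
  have comb: "s = 0 \<and> t = 0" if "s * x 1 + t * y 1 = 0" "s * x 2 + t * y 2 = 0" for s t
  proof -
    have sp: "cscale s ?g \<in> space ?M" "cscale t ?h \<in> space ?M" "cscale s ?g + cscale t ?h \<in> space ?M"
      by (auto simp: F1_ext_def bvec_def cscale_def)
    have "f (cscale s ?g + cscale t ?h) = cscale s x + cscale t y"
      using fa[OF sp(1,2)] fs[OF S(1)] fs[OF S(2)] by (simp add: x_def y_def)
    then show ?thesis using central[OF sp(3)] that by (simp add: cscale_def bvec_def)
  qed
  have det: "x 1 * y 2 \<noteq> x 2 * y 1"
  proof
    assume eq: "x 1 * y 2 = x 2 * y 1"
    have "y 1 = 0 \<and> - x 1 = 0" "y 2 = 0 \<and> - x 2 = 0"
      using comb[of "y 1" "- x 1"] comb[of "y 2" "- x 2"] eq by (simp_all add: mult_ac)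
    then show False using comb[of 1 0] by simp
  qed
  have "brk ?M ?g ?g = cscale r ?z" "brk ?M ?h ?g = cscale q ?z" "brk ?M ?h ?h = cscale (- p) ?z"
    by (auto simp: brM bvec_def fun_eq_iff cscale_def)
  then have "brk ?N x x = cscale r w" "brk ?N y x = cscale q w" "brk ?N y y = cscale (- p) w"
    using fb S fs by (metis x_def y_def w_def)+
  then have "brk ?N x x k = r * w k" "brk ?N y x k = q * w k" "brk ?N y y k = - p * w k" for k
    by (simp_all add: cscale_def)
  from this[of 3] this[of 4] show ?thesis
    by (intro pencil_equivalence[OF det nz, of r "w 3" q p "w 4"]) (simp_all add: brM)
qed

section \<open>The list meets every orbit once\<close>

lemma entries_cases:
  assumes "s \<in> entries"
  obtains a4 a3 where "s = EF a4 a3" "a4 \<in> {0, 1}" "a3 \<in> {0, 1}"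
  | "s = EL3 (- 1)" | "s = EL3 0" | "s = EL3 1" | lam where "s = EL4 lam" "lam \<noteq> 0"
  | "s = EL5 1 1" | "s = EL5 2 4" | "s = EL1"
  using assms by (auto simp: entries_def)

lemma L4_invariant_inj:
  fixes lam mu :: complex
  assumes "(1 - lam) * lam * mu\<^sup>2 = (1 - mu) * mu * lam\<^sup>2" "lam \<noteq> 0" "mu \<noteq> 0"
  shows "lam = mu"
proof -
  have "lam * mu * (lam - mu) = 0" using assms(1) by algebra
  then show ?thesis using assms(2,3) by simp
qed

text \<open>In the algebras of type \<open>L4\<close> one has \<open>p + r = 1\<close> and \<open>q = - r\<close>, so the ratio \<open>p r : q\<^sup>2\<close> is never \<open>- 1\<close>, its
  value for the algebra \<open>L5\<close> with parameters \<open>2, 4\<close>.\<close>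

lemma L4_invariant_neq:
  fixes p r :: complex
  assumes "p * r = - (r * r)" "r \<noteq> 0" "p + r = 1"
  shows False
proof -
  have "r * (p + r) = 0" using assms(1) by algebra
  then show ?thesis using assms by simp
qed

lemma entries_orbits_distinct:
  assumes "s \<in> entries" "t \<in> entries"
    and "entry_params s = (0, p, q, r)" "entry_params t = (0, p', q', r')"
    and "same_torus_orbit p q r p' q' r'"
  shows "s = t"
proof (cases "\<exists>lam mu. s = EL4 lam \<and> t = EL4 mu")
  case True
  then obtain lam mu where st: "s = EL4 lam" "t = EL4 mu" by blast
  then have "lam \<noteq> 0" "mu \<noteq> 0" using assms(1,2) by (auto simp: entries_def)
  then show ?thesis using st assms(3-5) L4_invariant_inj[of lam mu] by (auto simp: same_torus_orbit_def)
next
  case False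
  show ?thesis
    using assms(1)
    by (cases rule: entries_cases; use assms(2) in \<open>cases rule: entries_cases\<close>;
      use assms(3-5) False in \<open>auto simp: same_torus_orbit_def power2_eq_square algebra_simps dest: L4_invariant_neq L4_invariant_neq[OF sym]\<close>)
qed

text \<open>An exchange relates \<open>L3\<close> with parameter 1, where only \<open>r\<close> vanishes, to \<open>L4\<close> with parameter 1, where only \<open>p\<close>
  vanishes. The triples with nonzero \<open>p, q, r\<close> are separated by \<open>p r / q\<^sup>2\<close>, and the one with \<open>p = r = 0 \<noteq> q\<close> is alone.\<close>

lemma entries_orbits_swapped:
  assumes "s \<in> entries" "t \<in> entries"
    and "entry_params s = (0, p, q, r)" "entry_params t = (0, p', q', r')"
    and "swapped_torus_orbit p q r p' q' r'"
  shows "s = t \<or> {s, t} = {EL3 1, EL4 1}"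
proof (cases "\<exists>lam mu. s = EL4 lam \<and> t = EL4 mu")
  case True
  then obtain lam mu where st: "s = EL4 lam" "t = EL4 mu" by blast
  then have "lam \<noteq> 0" "mu \<noteq> 0" using assms(1,2) by (auto simp: entries_def)
  then show ?thesis using st assms(3-5) L4_invariant_inj[of lam mu] by (auto simp: swapped_torus_orbit_def)
next
  case False
  show ?thesis
    using assms(1)
    by (cases rule: entries_cases; use assms(2) in \<open>cases rule: entries_cases\<close>;
      use assms(3-5) False in \<open>auto simp: swapped_torus_orbit_def power2_eq_square algebra_simps dest: L4_invariant_neq L4_invariant_neq[OF sym]\<close>)
qed

lemma entry_params_nonzero:
  assumes "s \<in> entries" "entry_params s = (0, p, q, r)"
  shows "p \<noteq> 0 \<or> q \<noteq> 0 \<or> r \<noteq> 0"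
  using assms by (auto simp: entries_def)

lemma F1_ext_entries_not_iso:
  assumes n: "n \<ge> 3" and st: "s \<in> entries" "t \<in> entries" "s \<noteq> t"
    and ps: "entry_params s = (d, p, q, r)" and pt: "entry_params t = (d', p', q', r')"
    and iso: "alg_iso (F1_ext n d p q r) (F1_ext n d' p' q' r')"
  shows "n = 3 \<and> {s, t} = {EL3 1, EL4 1}"
proof -
  have dd: "d = 0 \<longleftrightarrow> d' = 0"
  proof
    show "d = 0" if "d' = 0" using F1_ext_iso_mixed[OF n, of d p q r p' q' r'] iso that by simp
    show "d' = 0" if "d = 0"
      using F1_ext_iso_mixed[OF n, of d' p' q' r' p q r] F1_ext_iso_sym[OF n iso] that by simp
  qed
  consider "d \<noteq> 0" "d' \<noteq> 0" | "d = 0" "d' = 0" "n \<ge> 4" | "d = 0" "d' = 0" "n = 3"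
    using dd n by linarith
  then show ?thesis
  proof cases
    case 1
    then have diag: "(d \<noteq> 0 \<and> d' \<noteq> 0) \<or> (n \<ge> 4 \<and> d = 0 \<and> d' = 0)" by blast
    obtain A S w where *: "A \<noteq> 0" "S \<noteq> 0" "A * S * q' = w * q" "S\<^sup>2 * r' = w * r"
      "d = 0 \<longrightarrow> A\<^sup>2 * p' = w * p" "d \<noteq> 0 \<longrightarrow> w \<noteq> 0"
      by (rule F1_ext_iso_diagonal[OF n iso diag])
    have zeros: "q' = 0 \<longleftrightarrow> q = 0" "r' = 0 \<longleftrightarrow> r = 0"
      using *(1,2) *(6) 1(1) arg_cong[OF *(3), of "\<lambda>v. v = 0"] arg_cong[OF *(4), of "\<lambda>v. v = 0"]
      by simp_all
    have "s = t"
      using st(1)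
      by (cases rule: entries_cases; use st(2) in \<open>cases rule: entries_cases\<close>;
          use 1 ps pt zeros in auto)
    then show ?thesis using st(3) by blast
  next
    case 2
    then have diag: "(d \<noteq> 0 \<and> d' \<noteq> 0) \<or> (n \<ge> 4 \<and> d = 0 \<and> d' = 0)" by blast
    obtain A S w where *: "A \<noteq> 0" "S \<noteq> 0" "A * S * q' = w * q" "S\<^sup>2 * r' = w * r"
      "d = 0 \<longrightarrow> A\<^sup>2 * p' = w * p" "d \<noteq> 0 \<longrightarrow> w \<noteq> 0"
      by (rule F1_ext_iso_diagonal[OF n iso diag])
    have "w \<noteq> 0" using *(1-5) 2(1) entry_params_nonzero[OF st(2)] pt 2 by auto
    then have "same_torus_orbit p q r p' q' r'"
      using same_torus_orbitI[OF *(1,2) _ *(5)[rule_format, OF 2(1)] *(3,4)] by simp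
    then have "s = t"
      using entries_orbits_distinct[OF st(1,2)] ps pt 2 by simp
    then show ?thesis using st(3) by simp
  next
    case 3
    then have "same_torus_orbit p q r p' q' r' \<or> swapped_torus_orbit p q r p' q' r'"
      using F1_ext_iso_dim4[of p q r p' q' r'] iso entry_params_nonzero[OF st(2), of p' q' r'] pt by simp
    then have "s = t \<or> {s, t} = {EL3 1, EL4 1}"
      using entries_orbits_distinct[OF st(1,2), of p q r p' q' r']
        entries_orbits_swapped[OF st(1,2), of p q r p' q' r'] ps pt 3 by auto
    then show ?thesis using st(3) 3(3) by simp
  qed
qed

lemma F1_ext_split_not_iso:
  assumes n: "n \<ge> 3" and t: "t \<in> entries" "entry_params t = (d, p, q, r)"
  shows "\<not> alg_iso (F1_ext n 0 0 0 0) (F1_ext n d p q r)"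
proof
  assume iso: "alg_iso (F1_ext n 0 0 0 0) (F1_ext n d p q r)"
  have "d = 0" by (rule F1_ext_iso_mixed[OF n F1_ext_iso_sym[OF n iso]])
  then have nz: "p \<noteq> 0 \<or> q \<noteq> 0 \<or> r \<noteq> 0" using entry_params_nonzero[OF t(1)] t(2) by simp
  show False
  proof (cases "n = 3")
    case True
    then have "same_torus_orbit 0 0 0 p q r \<or> swapped_torus_orbit 0 0 0 p q r"
      using F1_ext_iso_dim4[OF _ nz, of 0 0 0] iso \<open>d = 0\<close> by simp
    then show ?thesis using nz by (auto simp: same_torus_orbit_def swapped_torus_orbit_def)
  next
    case False
    then have diag: "(0 \<noteq> (0::complex) \<and> d \<noteq> 0) \<or> (n \<ge> 4 \<and> 0 = (0::complex) \<and> d = 0)"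
      using n \<open>d = 0\<close> by simp
    obtain A S w where "A \<noteq> 0" "S \<noteq> 0" "A * S * q = w * 0" "S\<^sup>2 * r = w * 0"
      "0 = (0::complex) \<longrightarrow> A\<^sup>2 * p = w * 0" "0 \<noteq> (0::complex) \<longrightarrow> w \<noteq> 0"
      by (rule F1_ext_iso_diagonal[OF n iso diag])
    then show ?thesis using nz by auto
  qed
qed

section \<open>The classification\<close>

theorem theorem4p2:
  fixes n :: nat
  assumes "n \<ge> 3"
  shows "(\<forall>(V :: ('u::ab_group_add) calg) i (E :: ('v::ab_group_add) calg) p.
            central_extension 1 V i E p (F1 n) \<longrightarrow>
              alg_iso E (alg_direct_sum (F1 n) abelian_line) \<or>
              (\<exists>s\<in>entries. alg_iso E (entry_alg (n + 1) s))) \<and>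
         (\<forall>s\<in>entries. \<not> alg_iso (alg_direct_sum (F1 n) abelian_line) (entry_alg (n + 1) s)) \<and>
         (\<forall>s\<in>entries. \<forall>t\<in>entries.
            s \<noteq> t \<and> \<not> (n = 3 \<and> {s, t} = {EL3 1, EL4 1}) \<longrightarrow>
              \<not> alg_iso (entry_alg (n + 1) s) (entry_alg (n + 1) t))"
proof (intro conjI allI ballI impI)
  fix V :: "'u calg" and i and E :: "'v calg" and \<pi>
  assume "central_extension 1 V i E \<pi> (F1 n)"
  then obtain d p q r where "alg_iso (F1_ext n d p q r) E"
    using central_extension_of_F1[OF assms] by blast
  then have E: "alg_iso E (F1_ext n d p q r)" by (rule F1_ext_iso_sym[OF assms])
  show "alg_iso E (alg_direct_sum (F1 n) abelian_line) \<or> (\<exists>s\<in>entries. alg_iso E (entry_alg (n + 1) s))"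
  proof (cases "d = 0 \<and> p = 0 \<and> q = 0 \<and> r = 0")
    case True
    then have "alg_iso E (alg_direct_sum (F1 n) abelian_line)"
      using alg_iso_trans[OF E] F1_ext_iso_split[OF assms] by simp
    then show ?thesis ..
  next
    case False
    then obtain s d' p' q' r' where s: "s \<in> entries" "entry_params s = (d', p', q', r')"
      "alg_iso (F1_ext n d' p' q' r') (F1_ext n d p q r)"
      using F1_ext_normal_form[OF assms, of d p q r] by blast
    have "alg_iso E (entry_alg (n + 1) s)"
      by (rule alg_iso_trans[OF E alg_iso_trans[OF F1_ext_iso_sym[OF assms s(3)]
              F1_ext_iso_entry[OF assms s(2)]]])
    then show ?thesis using s by blast
  qed
next
  fix s assume s: "s \<in> entries"
  obtain d p q r where ps: "entry_params s = (d, p, q, r)" by (metis prod_cases4)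
  show "\<not> alg_iso (alg_direct_sum (F1 n) abelian_line) (entry_alg (n + 1) s)"
  proof
    assume "alg_iso (alg_direct_sum (F1 n) abelian_line) (entry_alg (n + 1) s)"
    from alg_iso_trans[OF F1_ext_iso_split[OF assms] this]
    have "alg_iso (F1_ext n 0 0 0 0) (F1_ext n d p q r)"
      by (rule alg_iso_trans[OF _ F1_ext_iso_sym[OF assms F1_ext_iso_entry[OF assms ps]]])
    then show False using F1_ext_split_not_iso[OF assms s ps] by blast
  qed
next
  fix s t assume s: "s \<in> entries" and t: "t \<in> entries"
    and ne: "s \<noteq> t \<and> \<not> (n = 3 \<and> {s, t} = {EL3 1, EL4 1})"
  obtain d p q r where ps: "entry_params s = (d, p, q, r)" by (metis prod_cases4)
  obtain d' p' q' r' where pt: "entry_params t = (d', p', q', r')" by (metis prod_cases4)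
  show "\<not> alg_iso (entry_alg (n + 1) s) (entry_alg (n + 1) t)"
  proof
    assume "alg_iso (entry_alg (n + 1) s) (entry_alg (n + 1) t)"
    from alg_iso_trans[OF F1_ext_iso_entry[OF assms ps] this]
    have "alg_iso (F1_ext n d p q r) (F1_ext n d' p' q' r')"
      by (rule alg_iso_trans[OF _ F1_ext_iso_sym[OF assms F1_ext_iso_entry[OF assms pt]]])
    then show False using F1_ext_entries_not_iso[OF assms s t _ ps pt] ne by blast
  qed
qed

end
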